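(* Let the hypergraphs $\mathscr H=(V,E)$ and $\mathscr H^*=(R,E)$ be planar duals. Then the hypertree polytopes $Q_{\mathscr H}$ and $Q_{\mathscr H^*}$ in $\mathbf R^E$ are centrally symmetric to each other, i.e. there is a point $c\in\mathbf R^E$ with $Q_{\mathscr H^*}=\{2c-x\mid x\in Q_{\mathscr H}\}$. Furthermore, up to interchanging the names of the indeterminates $\xi$ and $\eta$, we have $I_{\mathscr H^*}=X_{\mathscr H}$ and $X_{\mathscr H^*}=I_{\mathscr H}$.
   Context: A hypergraph is a pair $\mathscr H=(V,E)$ with $V$ a finite set and $E$ a finite multiset of non-empty subsets of $V$ (hyperedges). $\mathrm{Bip}\,\mathscr H$ is the bipartite graph with color classes $V$ and $E$, with $v$ joined to $e$ iff $v\in e$; in the plane setting, multiple edges are allowed in bipartite graphs, and such a bipartite graph induces the same hypergraph as the graph obtained by reducing each set of multiple edges to a single edge. Planar duality: a plane hypergraph is $\mathscr H=(V,E)$ together with an embedding of $\mathrm{Bip}\,\mathscr H$ in the sphere $S^2$; $\mathrm{Bip}\,\mathscr H$ is assumed connected. Its regions are the connected components of the complement of the embedded graph. The planar dual hypergraph $\mathscr H^*=(R,E)$ has the same set $E$ of hyperedges, has as vertex set the set $R$ of regions, and a region $r\in R$ belongs to a hyperedge $e\in E$ iff $r$ is incident with the point representing $e$. Hypertrees: a hypertree in a hypergraph $(V,E)$ with connected $\mathrm{Bip}$ is a function $f\colon E\to\mathbf N=\{0,1,2,\ldots\}$ such that some spanning tree of the bipartite graph has degree $f(e)+1$ at each $e\in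 E$. The hypertree polytope $Q_{\mathscr H}\subset\mathbf R^E$ is the set of $f\in\mathbf R^E$ with $f(e)\ge0$ for all $e$, $\sum_{e\in E'}f(e)\le|\bigcup E'|-c(E')$ for all non-empty $E'\subset E$, and $\sum_{e\in E}f(e)=|V|-1$, where $\bigcup E'$ is the union of the hyperedges in $E'$ and $c(E')$ is the number of connected components of the bipartite graph with color classes $E'$, $\bigcup E'$ and edges inherited from $\mathrm{Bip}\,\mathscr H$. ($Q_{\mathscr H}$ is the convex hull of the hypertrees, and the hypertrees are its integer points.) Polynomials: a hypertree $f$ is such that a transfer of valence is possible from $a\in E$ to $b\in E$ ($a\ne b$) if decreasing $f(a)$ by $1$ and increasing $f(b)$ by $1$ yields another hypertree. Fix a total order on $E$. Let $\bar\iota(f)$ be the number of $e\in E$ from which a transfer of valence is possible at $f$ to some smaller hyperedge, and $\bar\varepsilon(f)$ the number of $e\in E$ to which a transfer of valence is possible at $f$ from some smaller hyperedge. The interior and exterior polynomials are $I_{\mathscr H}(\xi)=\sum_f\xi^{\bar\iota(f)}$ and $X_{\mathscr H}(\eta)=\sum_f\eta^{\bar\varepsilon(f)}$, summed over all hypertrees; they do not depend on the order. *)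

theory Defs
  imports "HOL-Analysis.Analysis" "HOL-Computational_Algebra.Polynomial"
begin

section \<open>Finite simple graphs\<close>

text \<open>
  A simple graph is a pair of a vertex set and a set of edges, each edge being a set of two
  vertices.
\<close>

type_synonym 'a ugraph = "'a set \<times> 'a set set"

definition ugraph_adj :: "'a ugraph \<Rightarrow> ('a \<times> 'a) set" where
  "ugraph_adj G = {(x, y). {x, y} \<in> snd G}"

definition ugraph_components :: "'a ugraph \<Rightarrow> 'a set set" where
  "ugraph_components G = fst G // ((ugraph_adj G)\<^sup>* \<inter> fst G \<times> fst G)"

text \<open>The empty graph is not regarded as connected.\<close>

definition ugraph_connected :: "'a ugraph \<Rightarrow> bool" where
  "ugraph_connected G \<longleftrightarrow>
     fst G \<noteq> {} \<and> (\<forall>x\<in>fst G. \<forall>y\<in>fst G. (x, y) \<in> (ugraph_adj G)\<^sup>*)"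

definition ugraph_cycle :: "'a ugraph \<Rightarrow> 'a list \<Rightarrow> bool" where
  "ugraph_cycle G xs \<longleftrightarrow>
     3 \<le> length xs \<and> distinct xs \<and>
     (\<forall>i<length xs. (xs ! i, xs ! (Suc i mod length xs)) \<in> ugraph_adj G)"

definition ugraph_tree :: "'a ugraph \<Rightarrow> bool" where
  "ugraph_tree G \<longleftrightarrow> ugraph_connected G \<and> (\<nexists>xs. ugraph_cycle G xs)"

definition spanning_tree :: "'a ugraph \<Rightarrow> 'a ugraph \<Rightarrow> bool" where
  "spanning_tree T G \<longleftrightarrow> fst T = fst G \<and> snd T \<subseteq> snd G \<and> ugraph_tree T"

definition ugraph_degree :: "'a ugraph \<Rightarrow> 'a \<Rightarrow> nat" where
  "ugraph_degree G x = card {t \<in> snd G. x \<in> t}"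

section \<open>Hypergraphs\<close>

text \<open>
  The multiset of hyperedges is given as a family of subsets of the vertex set, indexed by the
  set \<open>hedges\<close>; repeated hyperedges are distinct indices with equal \<open>hinc\<close>.
\<close>

record ('v, 'e) hypergraph =
  hverts :: "'v set"
  hedges :: "'e set"
  hinc :: "'e \<Rightarrow> 'v set"

definition is_hypergraph :: "('v, 'e) hypergraph \<Rightarrow> bool" where
  "is_hypergraph H \<longleftrightarrow>
     finite (hverts H) \<and> finite (hedges H) \<and>
     (\<forall>e\<in>hedges H. hinc H e \<noteq> {} \<and> hinc H e \<subseteq> hverts H)"

definition incidences :: "('v, 'e) hypergraph \<Rightarrow> ('v \<times> 'e) set" where
  "incidences H = {(v, e). v \<in> hverts H \<and> e \<in> hedges H \<and> v \<in> hinc H e}"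

definition Bip :: "('v, 'e) hypergraph \<Rightarrow> ('v + 'e) ugraph" where
  "Bip H = (hverts H <+> hedges H, (\<lambda>(v, e). {Inl v, Inr e}) ` incidences H)"

definition hrestrict :: "('v, 'e) hypergraph \<Rightarrow> 'e set \<Rightarrow> ('v, 'e) hypergraph" where
  "hrestrict H E' = \<lparr>hverts = \<Union>(hinc H ` E'), hedges = E', hinc = hinc H\<rparr>"

definition num_comps :: "('v, 'e) hypergraph \<Rightarrow> 'e set \<Rightarrow> nat" where
  "num_comps H E' = card (ugraph_components (Bip (hrestrict H E')))"

section \<open>Hypertrees and their polynomials\<close>

text \<open>
  Functions on the hyperedge set are represented extensionally, i.e. they are \<open>undefined\<close>
  outside of it, so that equality of functions is equality on the hyperedge set.
\<close>

definition hypertrees :: "('v, 'e) hypergraph \<Rightarrow> ('e \<Rightarrow> nat) set" where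
  "hypertrees H =
     {f \<in> hedges H \<rightarrow>\<^sub>E UNIV. \<exists>T. spanning_tree T (Bip H) \<and>
        (\<forall>e\<in>hedges H. ugraph_degree T (Inr e) = f e + 1)}"

definition hypertree_polytope :: "('v, 'e) hypergraph \<Rightarrow> ('e \<Rightarrow> real) set" where
  "hypertree_polytope H =
     {x \<in> hedges H \<rightarrow>\<^sub>E UNIV.
        (\<forall>e\<in>hedges H. 0 \<le> x e) \<and>
        (\<forall>E'. E' \<noteq> {} \<and> E' \<subseteq> hedges H \<longrightarrow>
           (\<Sum>e\<in>E'. x e) \<le> real (card (\<Union>(hinc H ` E'))) - real (num_comps H E')) \<and>
        (\<Sum>e\<in>hedges H. x e) = real (card (hverts H)) - 1}"

text \<open>The condition \<open>0 < f a\<close> guards against truncated subtraction.\<close>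

definition transfer_possible ::
    "('v, 'e) hypergraph \<Rightarrow> ('e \<Rightarrow> nat) \<Rightarrow> 'e \<Rightarrow> 'e \<Rightarrow> bool" where
  "transfer_possible H f a b \<longleftrightarrow>
     a \<in> hedges H \<and> b \<in> hedges H \<and> a \<noteq> b \<and> 0 < f a \<and>
     f(a := f a - 1, b := f b + 1) \<in> hypertrees H"

text \<open>
  A total order on the hyperedges is a relation \<open>r\<close> with \<open>linear_order_on (hedges H) r\<close>,
  where \<open>(a, b) \<in> r\<close> means that \<open>a\<close> is smaller than or equal to \<open>b\<close>.
\<close>

definition internal_inactivity ::
    "('e \<times> 'e) set \<Rightarrow> ('v, 'e) hypergraph \<Rightarrow> ('e \<Rightarrow> nat) \<Rightarrow> nat" where
  "internal_inactivity r H f =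
     card {e \<in> hedges H. \<exists>b. b \<noteq> e \<and> (b, e) \<in> r \<and> transfer_possible H f e b}"

definition external_inactivity ::
    "('e \<times> 'e) set \<Rightarrow> ('v, 'e) hypergraph \<Rightarrow> ('e \<Rightarrow> nat) \<Rightarrow> nat" where
  "external_inactivity r H f =
     card {e \<in> hedges H. \<exists>a. a \<noteq> e \<and> (a, e) \<in> r \<and> transfer_possible H f a e}"

definition interior_polynomial ::
    "('e \<times> 'e) set \<Rightarrow> ('v, 'e) hypergraph \<Rightarrow> int poly" where
  "interior_polynomial r H = (\<Sum>f\<in>hypertrees H. monom 1 (internal_inactivity r H f))"

definition exterior_polynomial ::
    "('e \<times> 'e) set \<Rightarrow> ('v, 'e) hypergraph \<Rightarrow> int poly" where
  "exterior_polynomial r H = (\<Sum>f\<in>hypertrees H. monom 1 (external_inactivity r H f))"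

section \<open>Plane hypergraphs and planar duality\<close>

text \<open>
  A drawing on the unit sphere of a bipartite graph, possibly with multiple edges, on the vertices
  and hyperedges of a hypergraph. The set \<open>dedges\<close> contains the names of the edges of the bipartite
  graph, and \<open>dends k\<close> consists of the vertex and the hyperedge joined by the edge \<open>k\<close>.
\<close>

record ('v, 'e, 'k) drawing =
  dedges :: "'k set"
  dends :: "'k \<Rightarrow> 'v \<times> 'e"
  dpoint :: "'v + 'e \<Rightarrow> real^3"
  dcurve :: "'k \<Rightarrow> real \<Rightarrow> real^3"

definition drawn_points :: "('v, 'e) hypergraph \<Rightarrow> ('v, 'e, 'k) drawing \<Rightarrow> (real^3) set" where
  "drawn_points H D = dpoint D ` (hverts H <+> hedges H)"

text \<open>
  The condition \<open>dends D ` dedges D = incidences H\<close> says that reducing each set of multiple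
  edges to a single one turns the drawn bipartite graph into \<open>Bip H\<close>.
\<close>

definition plane_hypergraph :: "('v, 'e) hypergraph \<Rightarrow> ('v, 'e, 'k) drawing \<Rightarrow> bool" where
  "plane_hypergraph H D \<longleftrightarrow>
     is_hypergraph H \<and> ugraph_connected (Bip H) \<and>
     finite (dedges D) \<and> dends D ` dedges D = incidences H \<and>
     inj_on (dpoint D) (hverts H <+> hedges H) \<and> drawn_points H D \<subseteq> sphere 0 1 \<and>
     (\<forall>k\<in>dedges D.
        arc (dcurve D k) \<and> path_image (dcurve D k) \<subseteq> sphere 0 1 \<and>
        pathstart (dcurve D k) = dpoint D (Inl (fst (dends D k))) \<and>
        pathfinish (dcurve D k) = dpoint D (Inr (snd (dends D k))) \<and>
        path_image (dcurve D k) \<inter> drawn_points H D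
          = {pathstart (dcurve D k), pathfinish (dcurve D k)}) \<and>
     (\<forall>k\<in>dedges D. \<forall>l\<in>dedges D. k \<noteq> l \<longrightarrow>
        path_image (dcurve D k) \<inter> path_image (dcurve D l) \<subseteq> drawn_points H D)"

definition drawn_graph :: "('v, 'e) hypergraph \<Rightarrow> ('v, 'e, 'k) drawing \<Rightarrow> (real^3) set" where
  "drawn_graph H D = drawn_points H D \<union> (\<Union>k\<in>dedges D. path_image (dcurve D k))"

definition regions :: "('v, 'e) hypergraph \<Rightarrow> ('v, 'e, 'k) drawing \<Rightarrow> (real^3) set set" where
  "regions H D = components (sphere 0 1 - drawn_graph H D)"

text \<open>A region is incident with a point of the drawn graph if the point lies in its closure.\<close>

definition planar_dual ::
    "('v, 'e) hypergraph \<Rightarrow> ('v, 'e, 'k) drawing \<Rightarrow> ((real^3) set, 'e) hypergraph" where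
  "planar_dual H D =
     \<lparr>hverts = regions H D, hedges = hedges H,
      hinc = (\<lambda>e. {r \<in> regions H D. dpoint D (Inr e) \<in> closure r})\<rparr>"

end

theory Submission
  imports Defs
begin

text \<open>
  Write \<open>g(A)\<close> for the rank of the cycle matroid of the bipartite graph on the edges at \<open>A \<subseteq> E\<close>,
  minus \<open>|A|\<close>; this is the bound \<open>|\<Union>A| - c(A)\<close> in the hypertree polytope. By Rado's theorem the
  hypertrees are exactly the integer points of the polytope, so both claims follow once the rank
  functions of the two hypergraphs are dual, i.e. once
  \<open>g\<^sup>*(E - A) = \<delta>(E - A) + g(A) - g(E)\<close> where \<open>\<delta>(e)\<close> is the number of drawn edges at \<open>e\<close> minus one:
  then \<open>x \<mapsto> \<delta> - x\<close> exchanges the polytopes and reverses transfers of valence. Now remove from the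
  drawing all the edges at \<open>E - A\<close>. Euler's formula counts the regions that remain, and these
  regions correspond to the components of the part of the dual graph spanned by the
  regions of the full drawing and \<open>E - A\<close>. The plane topology is reduced to Janiszewski's theorem and
  the Jordan curve theorem by stereographic projection.
\<close>

section \<open>Topology of the sphere\<close>

text \<open>No drawing of the dual is ever constructed: \<open>planar_dual\<close> is given by
  regions and their closures alone. The double dual therefore never enters, and both directions of
  the symmetry come from a single equivalence between the two polytopes. The deletion of edges works
  because every arc ends at a hyperedge point. Once all arcs at a hyperedge are gone, its point is
  isolated and does not separate, so exactly the regions touching it flow together; they are its
  neighbours in the dual bipartite graph. Keep only the edges at \<open>A\<close>, let
  \<open>m(A)\<close> be their number and \<open>k\<close> the number of regions left. Euler's
  formula reads \<open>k + g(A) + |A| = 1 + m(A)\<close>, while the dual graph on the regions and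
  \<open>E - A\<close>, with \<open>A\<close> as isolated nodes, has \<open>k + |A|\<close>
  components. Eliminating \<open>k\<close> gives the identity of the ranks. Multiple edges are
  invisible to hypertrees but counted by \<delta>: a parallel edge creates a region and leaves the
  rank unchanged.\<close>

abbreviation S2 :: "(real^3) set" where "S2 \<equiv> sphere 0 1"

text \<open>The model plane is \<open>complex\<close>, where Janiszewski's theorem and the Jordan
  curve theorem are applied. It is reached through a hyperplane of the same dimension.\<close>

lemma stereographic:
  assumes "p \<in> S2"
  obtains h k where "homeomorphism (S2 - {p}) (UNIV :: complex set) h k"
proof -
  have "(S2 - {p}) homeomorphic (UNIV :: complex set)"
  proof -
    have "S2 - {p} homeomorphic {x::real^3. axis 1 1 \<bullet> x = 0}"
      using assms by (intro homeomorphic_punctured_sphere_hyperplane) (auto simp: axis_eq_0_iff)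
    also have "\<dots> homeomorphic (UNIV :: complex set)"
      by (subst homeomorphic_affine_sets_eq) (auto simp: affine_hyperplane axis_eq_0_iff)
    finally show ?thesis .
  qed
  then show ?thesis
    using that unfolding homeomorphic_def by blast
qed

lemma connected_S2: "connected S2"
  by (rule connected_sphere) simp

lemma openin_S2_diff:
  assumes "openin (top_of_set S2) U" "closed C"
  shows "openin (top_of_set S2) (U - C)"
  using assms by (metis Diff_Compl Int_commute double_complement open_Compl openin_Int_open Diff_eq)

text \<open>If \<open>U\<close> misses a point, projecting from that point reduces the claim to
  connected open sets of the plane. If \<open>U\<close> is the whole sphere, the punctured sphere is
  itself a plane.\<close>

lemma connected_S2_delete:
  assumes U: "openin (top_of_set S2) U" and "connected U"
  shows "connected (U - {p})"
proof (cases "p \<in> U")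
  case False
  with assms show ?thesis by simp
next
  case True
  then have p: "p \<in> S2"
    using openin_subset[OF U] by auto
  show ?thesis
  proof (cases "U = S2")
    case True
    obtain h k where "homeomorphism (S2 - {p}) (UNIV :: complex set) h k"
      using stereographic p by blast
    then have "(S2 - {p}) homeomorphic (UNIV :: complex set)"
      unfolding homeomorphic_def by blast
    then show ?thesis
      using True homeomorphic_connectedness connected_UNIV by blast
  next
    case False
    then obtain q where q: "q \<in> S2" "q \<notin> U"
      using openin_imp_subset[OF U] by blast
    obtain h k where hk: "homeomorphism (S2 - {q}) (UNIV :: complex set) h k"
      using stereographic q by blast
    have Uq: "U \<subseteq> S2 - {q}"
      using q openin_subset[OF U] by auto
    have "openin (top_of_set (S2 - {q})) U"
      using U Uq by (meson Diff_subset openin_subset_trans)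
    then have "open (h ` U)"
      using homeomorphism_imp_open_map[OF hk] by simp
    moreover have "connected (h ` U)"
      using hk Uq \<open>connected U\<close>
      by (meson connected_continuous_image continuous_on_subset homeomorphism_def)
    ultimately have "connected (h ` U - {h p})"
      by (intro connected_open_delete) auto
    moreover have kh: "\<And>x. x \<in> U \<Longrightarrow> k (h x) = x"
      using hk Uq by (meson homeomorphism_apply1 subsetD)
    have "k ` (h ` U - {h p}) = U - {p}"
      using kh True by (auto simp: image_iff) (metis DiffI image_eqI singletonD)
    moreover have "continuous_on (h ` U - {h p}) k"
      using hk by (meson continuous_on_subset homeomorphism_def subset_UNIV)
    ultimately show ?thesis
      by (metis connected_continuous_image)
  qed
qed

section \<open>Points and arcs do not fill open subsets of the sphere\<close>

text \<open>Invariance of dimension, read in a stereographic chart around a point \<open>u\<close>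
  of \<open>U\<close> with the antipode as pole. It is used with the inverse of an arc, and with a
  constant function on a single point.\<close>

lemma S2_open_not_line:
  fixes f :: "real^3 \<Rightarrow> real"
  assumes U: "openin (top_of_set S2) U" and "U \<noteq> {}"
    and f: "continuous_on U f" "inj_on f U"
  shows False
proof -
  obtain u where u: "u \<in> U"
    using assms by auto
  then have "u \<in> S2"
    using openin_imp_subset[OF U] by blast
  then have "u \<noteq> 0" by auto
  have "- u \<noteq> u"
  proof
    assume "- u = u"
    then have "u + u = 0" by (metis add.right_inverse)
    then have "2 *\<^sub>R u = 0" by (simp only: scaleR_2)
    then show False using \<open>u \<noteq> 0\<close> by simp
  qed
  with \<open>u \<in> S2\<close> have uS: "u \<in> S2" "- u \<in> S2" "- u \<noteq> u" by auto
  obtain h k where hk: "homeomorphism (S2 - {- u}) (UNIV :: complex set) h k"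
    using stereographic uS by blast
  define W where "W = U - {- u}"
  have W: "W \<subseteq> S2 - {-u}" "u \<in> W" "W \<subseteq> U"
    using u uS openin_subset[OF U] by (auto simp: W_def)
  have "openin (top_of_set S2) W"
    unfolding W_def using U by (intro openin_S2_diff) auto
  then have "openin (top_of_set (S2 - {-u})) W"
    using W by (meson Diff_subset openin_subset_trans)
  then have "open (h ` W)"
    using homeomorphism_imp_open_map[OF hk] by simp
  moreover have kh: "\<And>x. x \<in> W \<Longrightarrow> k (h x) = x"
    using hk W by (meson homeomorphism_apply1 subsetD)
  then have khW: "k ` h ` W = W"
    by (auto simp: image_iff)
  have "continuous_on (h ` W) (f \<circ> k)"
  proof (rule continuous_on_compose)
    show "continuous_on (h ` W) k"
      using hk by (meson continuous_on_subset homeomorphism_def subset_UNIV)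
    show "continuous_on (k ` h ` W) f"
      unfolding khW using f W by (meson continuous_on_subset)
  qed
  moreover have "inj_on (f \<circ> k) (h ` W)"
    using f(2) W kh by (auto simp: inj_on_def)
  ultimately have "DIM(complex) \<le> DIM(real)"
    using W by (intro invariance_of_dimension[of "h ` W" "f \<circ> k"]) auto
  then show False by simp
qed

lemma S2_open_diff_arc:
  assumes "openin (top_of_set S2) U" "U \<noteq> {}" "arc g"
  shows "U - path_image g \<noteq> {}"
proof
  assume "U - path_image g = {}"
  then have sub: "U \<subseteq> path_image g" by blast
  obtain f where f: "homeomorphism {0..1} (path_image g) g f"
    using homeomorphism_arc[OF \<open>arc g\<close>] .
  have "continuous_on U f"
    using f sub by (meson continuous_on_subset homeomorphism_def)
  moreover have "inj_on f U"
    by (rule inj_on_inverseI[where g = g]) (use homeomorphism_apply2[OF f] sub in blast)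
  ultimately show False
    using S2_open_not_line assms by blast
qed

lemma S2_open_diff_finite:
  assumes "openin (top_of_set S2) U" "U \<noteq> {}" "finite P"
  shows "U - P \<noteq> {}"
  using assms(3,1,2)
proof (induction P arbitrary: U)
  case (insert x P)
  have "openin (top_of_set S2) (U - {x})"
    using insert.prems by (intro openin_S2_diff) auto
  moreover have "U - {x} \<noteq> {}"
  proof
    assume "U - {x} = {}"
    then have "U \<subseteq> {x}" by blast
    then have "inj_on (\<lambda>_. 0::real) U"
      by (auto simp: inj_on_def)
    then show False
      using S2_open_not_line[of U "\<lambda>_. 0"] insert.prems by auto
  qed
  ultimately have "U - {x} - P \<noteq> {}"
    by (rule insert.IH)
  moreover have "U - {x} - P = U - insert x P" by blast
  ultimately show ?case by simp
qed auto

lemma S2_open_diff_arcs: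
  assumes "openin (top_of_set S2) U" "U \<noteq> {}" "finite A" "\<And>g. g \<in> A \<Longrightarrow> arc g"
  shows "U - (\<Union>g\<in>A. path_image g) \<noteq> {}"
  using assms(3,1,2,4)
proof (induction A arbitrary: U)
  case (insert x P)
  have "openin (top_of_set S2) (U - path_image x)"
    using insert.prems by (intro openin_S2_diff) (auto intro: closed_arc_image)
  moreover have "U - path_image x \<noteq> {}"
    using insert.prems by (intro S2_open_diff_arc) auto
  ultimately have "U - path_image x - (\<Union>g\<in>P. path_image g) \<noteq> {}"
    using insert.IH insert.prems(3) by blast
  moreover have "U - path_image x - (\<Union>g\<in>P. path_image g) = U - (\<Union>g\<in>insert x P. path_image g)"
    by blast
  ultimately show ?case by simp
qed auto

text \<open>The sphere is locally connected, so the component of \<open>x\<close> is open and stays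
  connected when a point is deleted. This allows a pole to be removed from a complement.\<close>

lemma connected_component_S2_delete:
  assumes "closed C" "connected_component (S2 - C) x y" "x \<noteq> p" "y \<noteq> p"
  shows "connected_component (S2 - C - {p}) x y"
proof -
  let ?W = "connected_component_set (S2 - C) x"
  have o: "openin (top_of_set S2) (S2 - C)"
    using assms by (intro openin_S2_diff) auto
  have "openin (top_of_set (S2 - C)) ?W"
    by (intro openin_connected_component_locally_connected)
       (meson o locally_open_subset locally_connected_sphere)
  then have "openin (top_of_set S2) ?W"
    using o openin_trans by blast
  then have "connected (?W - {p})"
    by (intro connected_S2_delete) auto
  moreover have "?W - {p} \<subseteq> S2 - C - {p}"
    using connected_component_subset by blast
  moreover have "x \<in> ?W - {p}" "y \<in> ?W - {p}"
    using assms connected_component_in by force+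
  ultimately show ?thesis
    unfolding connected_component_def by blast
qed

lemma connected_component_image:
  assumes "connected_component A x y" "continuous_on A f" "f ` A \<subseteq> B"
  shows "connected_component B (f x) (f y)"
proof -
  obtain T where T: "connected T" "T \<subseteq> A" "x \<in> T" "y \<in> T"
    using assms(1) unfolding connected_component_def by blast
  then have "connected (f ` T)"
    using assms(2) by (meson connected_continuous_image continuous_on_subset)
  then show ?thesis
    unfolding connected_component_def using T assms(3) by blast
qed

section \<open>Separation theorems on the sphere\<close>

text \<open>A pole off both sets and different from \<open>x\<close> and \<open>y\<close> exists
  because a nonempty open set is not finite. Deleting the pole does not separate \<open>x\<close>
  from \<open>y\<close> in either complement, so the hypotheses pass to the plane and the conclusion
  passes back.\<close>

lemma Janiszewski_S2:
  assumes S: "compact S" "S \<subseteq> S2" and T: "compact T" "T \<subseteq> S2" and con: "connected (S \<inter> T)"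
    and ccS: "connected_component (S2 - S) x y" and ccT: "connected_component (S2 - T) x y"
  shows "connected_component (S2 - (S \<union> T)) x y"
proof -
  have xy: "x \<in> S2 - (S \<union> T)" "y \<in> S2 - (S \<union> T)"
    using ccS ccT connected_component_in by fast+
  have "openin (top_of_set S2) (S2 - (S \<union> T))"
    using S T by (intro openin_S2_diff) (auto intro: compact_imp_closed)
  then have "S2 - (S \<union> T) - {x,y} \<noteq> {}"
    by (rule S2_open_diff_finite) (use xy in blast, simp)
  then obtain p where p: "p \<in> S2" "p \<notin> S" "p \<notin> T" "p \<noteq> x" "p \<noteq> y"
    by blast
  obtain h k where hk: "homeomorphism (S2 - {p}) (UNIV :: complex set) h k"
    using stereographic p by blast
  have h: "continuous_on (S2 - {p}) h" and k: "continuous_on UNIV k"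
    and kh: "\<And>x. x \<in> S2 - {p} \<Longrightarrow> k (h x) = x" and hk': "\<And>z. h (k z) = z"
    and kin: "\<And>z. k z \<in> S2 - {p}"
    using hk unfolding homeomorphism_def by blast+
  have cpt: "compact (h ` A)" if "compact A" "A \<subseteq> S2" "p \<notin> A" for A
    using that by (intro compact_continuous_image continuous_on_subset[OF h]) auto
  have im: "h ` (S2 - A - {p}) \<subseteq> - h ` A" if "A \<subseteq> S2" "p \<notin> A" for A
  proof
    fix z assume "z \<in> h ` (S2 - A - {p})"
    then obtain x where x: "z = h x" "x \<in> S2 - {p}" "x \<notin> A" by blast
    show "z \<in> - h ` A"
    proof
      assume "z \<in> h ` A"
      then obtain y where y: "z = h y" "y \<in> A" by blast
      then have "y \<in> S2 - {p}" using that by auto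
      then have "k z = y" using kh y by simp
      moreover have "k z = x" using kh[OF x(2)] x(1) by simp
      ultimately show False using x y by simp
    qed
  qed
  have cc: "connected_component (- h ` A) (h x) (h y)"
    if "connected_component (S2 - A) x y" "compact A" "A \<subseteq> S2" "p \<notin> A" for A
  proof (rule connected_component_image[where f = h])
    show "connected_component (S2 - A - {p}) x y"
      using that p by (intro connected_component_S2_delete) (auto intro: compact_imp_closed)
    show "continuous_on (S2 - A - {p}) h"
      by (rule continuous_on_subset[OF h]) auto
  qed (use im that in blast)
  have "connected (h ` (S \<inter> T))"
    using con S p by (intro connected_continuous_image continuous_on_subset[OF h]) auto
  moreover have "h ` (S \<inter> T) = h ` S \<inter> h ` T"
  proof
    show "h ` S \<inter> h ` T \<subseteq> h ` (S \<inter> T)"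
    proof clarsimp
      fix a b assume ab: "a \<in> S" "b \<in> T" "h a = h b"
      then have "a \<in> S2 - {p}" "b \<in> S2 - {p}"
        using S T p by auto
      from kh[OF this(1)] kh[OF this(2)] have "a = b" using ab(3) by metis
      then show "h b \<in> h ` (S \<inter> T)" using ab by auto
    qed
  qed auto
  ultimately have "connected (h ` S \<inter> h ` T)" by simp
  moreover have "closed (h ` T)"
    using cpt[OF T] p by (simp add: compact_imp_closed)
  ultimately have c: "connected_component (- (h ` S \<union> h ` T)) (h x) (h y)"
    using cpt[OF S] cc[OF ccS S] cc[OF ccT T] p by (intro Janiszewski) auto
  have "connected_component (S2 - (S \<union> T)) (k (h x)) (k (h y))"
  proof (rule connected_component_image[OF c, where f = k])
    show "continuous_on (- (h ` S \<union> h ` T)) k"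
      using k continuous_on_subset by blast
    show "k ` (- (h ` S \<union> h ` T)) \<subseteq> S2 - (S \<union> T)"
    proof
      fix w assume "w \<in> k ` (- (h ` S \<union> h ` T))"
      then obtain z where z: "w = k z" "z \<notin> h ` S" "z \<notin> h ` T" by blast
      have "h w = z" using z hk' by simp
      then have "w \<notin> S" "w \<notin> T" using z by blast+
      then show "w \<in> S2 - (S \<union> T)" using kin z(1) by blast
    qed
  qed
  moreover have "x \<in> S2 - {p}" "y \<in> S2 - {p}"
    using xy p by auto
  ultimately show ?thesis
    by (simp only: kh)
qed

text \<open>In the plane a homeomorphic copy of a compact interval has connected complement. The
  pole is then put back as a limit point.\<close>

lemma connected_S2_diff_arc:
  assumes "arc g" "path_image g \<subseteq> S2"
  shows "connected (S2 - path_image g)"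
proof -
  let ?T = "path_image g"
  have oT: "openin (top_of_set S2) (S2 - ?T)"
    using assms by (intro openin_S2_diff) (auto intro: closed_arc_image)
  have "S2 - ?T \<noteq> {}"
    using assms by (intro S2_open_diff_arc) auto
  then obtain p where p: "p \<in> S2" "p \<notin> ?T" by blast
  obtain h k where hk: "homeomorphism (S2 - {p}) (UNIV :: complex set) h k"
    using stereographic p by blast
  have Tp: "?T \<subseteq> S2 - {p}" using assms p by auto
  have homT: "homeomorphism ?T (h ` ?T) h k"
    by (rule homeomorphism_of_subsets[OF hk Tp]) auto
  have "h ` ?T homeomorphic ?T"
    using homT by (metis homeomorphic_def homeomorphic_sym)
  also have "?T homeomorphic {0..1::real}"
    using assms homeomorphic_arc_image_interval zero_less_one by blast
  finally have "connected (- h ` ?T)"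
    by (intro connected_complement_homeomorphic_convex_compact) auto
  then have "connected (k ` (- h ` ?T))"
    using hk by (meson connected_continuous_image continuous_on_subset homeomorphism_def subset_UNIV)
  moreover have "k ` (- h ` ?T) = S2 - ?T - {p}"
  proof -
    have a: "\<And>x. x \<in> S2 - {p} \<Longrightarrow> k (h x) = x" "\<And>z. h (k z) = z" "\<And>z. k z \<in> S2 - {p}"
      using hk unfolding homeomorphism_def by blast+
    show ?thesis
    proof (intro equalityI subsetI)
      fix y assume "y \<in> k ` (- h ` ?T)"
      then obtain z where "z \<notin> h ` ?T" "y = k z" by blast
      then show "y \<in> S2 - ?T - {p}"
        using a(2)[of z] a(3)[of z] by (auto simp: image_iff)
    next
      fix y assume y: "y \<in> S2 - ?T - {p}"
      have "h y \<notin> h ` ?T"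
      proof
        assume "h y \<in> h ` ?T"
        then obtain t where "t \<in> ?T" "h y = h t" by blast
        moreover have "k (h y) = y" "k (h t) = t"
          using a(1)[of y] a(1)[of t] y Tp \<open>t \<in> ?T\<close> by blast+
        ultimately show False
          using y by (metis DiffD1 DiffD2)
      qed
      then show "y \<in> k ` (- h ` ?T)"
        using a(1)[of y] y by (metis ComplI DiffD1 DiffD2 DiffI image_eqI)
    qed
  qed
  ultimately have con: "connected (S2 - ?T - {p})" by simp
  \<comment> \<open>Otherwise \<open>p\<close> would be the only point of some nonempty open subset
    of the sphere.\<close>
  have "p \<in> closure (S2 - ?T - {p})"
  proof (rule ccontr)
    assume "p \<notin> closure (S2 - ?T - {p})"
    then have "openin (top_of_set S2) ((S2 - ?T) - closure (S2 - ?T - {p}))"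
         "(S2 - ?T) - closure (S2 - ?T - {p}) \<noteq> {}"
      using oT p by (auto intro!: openin_S2_diff)
    then have "(S2 - ?T) - closure (S2 - ?T - {p}) - {p} \<noteq> {}"
      using S2_open_diff_finite finite.emptyI finite.insertI by blast
    then show False
      using closure_subset[of "S2 - ?T - {p}"] by blast
  qed
  then show ?thesis
    using con p closure_subset[of "S2 - ?T - {p}"]
    by (intro connected_intermediate_closure[OF con]) auto
qed

text \<open>With a pole off the curve, the two sides are the preimages of the inside and of the
  outside, the latter completed by the pole. The closure statements come from the frontiers in the
  plane.\<close>

lemma Jordan_S2:
  assumes a: "arc a" "path_image a \<subseteq> S2" and b: "arc b" "path_image b \<subseteq> S2"
    and ends: "pathstart b = pathstart a" "pathfinish b = pathfinish a"
    and int: "path_image a \<inter> path_image b = {pathstart a, pathfinish a}"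
  obtains U V where "openin (top_of_set S2) U" "openin (top_of_set S2) V" "U \<inter> V = {}"
    "U \<union> V = S2 - (path_image a \<union> path_image b)" "connected U" "connected V"
    "path_image a \<union> path_image b \<subseteq> closure U" "path_image a \<union> path_image b \<subseteq> closure V"
proof -
  let ?C = "path_image a \<union> path_image b"
  have "S2 - (\<Union>g\<in>{a,b}. path_image g) \<noteq> {}"
    using a b connected_S2 by (intro S2_open_diff_arcs) auto
  then obtain p where p: "p \<in> S2" "p \<notin> ?C" by blast
  obtain h k where hk: "homeomorphism (S2 - {p}) (UNIV :: complex set) h k"
    using stereographic p by blast
  have kh: "k (h x) = x" if "x \<in> S2 - {p}" for x
    using hk that by (rule homeomorphism_apply1)
  have hkz: "h (k z) = z" for z
    using hk by (rule homeomorphism_apply2) simp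
  have ran: "range k = S2 - {p}"
    using hk by (simp add: homeomorphism_def)
  have kin: "k z \<in> S2 - {p}" for z
    using ran by blast
  have h: "continuous_on (S2 - {p}) h" and "continuous_on UNIV k"
    using hk by (auto simp: homeomorphism_def)
  then have k: "continuous_on A k" for A
    using continuous_on_subset by blast
  have sub: "path_image a \<subseteq> S2 - {p}" "path_image b \<subseteq> S2 - {p}"
    using a b p by auto
  have injh: "inj_on h (S2 - {p})"
    using kh by (rule inj_on_inverseI)
  have arch: "arc (h \<circ> g)" if "arc g" "path_image g \<subseteq> S2 - {p}" for g
    unfolding arc_def
  proof
    show "path (h \<circ> g)"
      using that h by (meson arc_def continuous_on_subset path_continuous_image)
    show "inj_on (h \<circ> g) {0..1}"
      using that inj_on_subset[OF injh] by (auto simp: arc_def path_image_def intro: comp_inj_on)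
  qed
  define c where "c = (h \<circ> a) +++ reversepath (h \<circ> b)"
  have pic: "path_image c = h ` ?C"
    unfolding c_def using ends
    by (subst path_image_join)
       (auto simp: path_image_compose pathfinish_compose)
  have "simple_path c"
    unfolding c_def
  proof (rule simple_path_join_loop)
    show "arc (h \<circ> a)" "arc (reversepath (h \<circ> b))"
      using arch a b sub by (auto intro: arc_reversepath)
    have "path_image (h \<circ> a) \<inter> path_image (reversepath (h \<circ> b))
        = h ` (path_image a \<inter> path_image b)"
      using inj_on_image_Int[OF injh sub] by (simp add: path_image_compose)
    then show "path_image (h \<circ> a) \<inter> path_image (reversepath (h \<circ> b))
      \<subseteq> {pathstart (h \<circ> a), pathstart (reversepath (h \<circ> b))}"
      using ends by (simp add: int pathstart_compose pathfinish_compose)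
  qed (use ends in \<open>auto simp: pathstart_compose pathfinish_compose\<close>)
  moreover have "pathfinish c = pathstart c"
    using ends by (simp add: c_def pathstart_compose)
  ultimately have J: "open (inside (path_image c))" "connected (inside (path_image c))"
    "open (outside (path_image c))" "connected (outside (path_image c))"
    "bounded (inside (path_image c))" "\<not> bounded (outside (path_image c))"
    "inside (path_image c) \<inter> outside (path_image c) = {}"
    "inside (path_image c) \<union> outside (path_image c) = - path_image c"
    "frontier (inside (path_image c)) = path_image c"
    "frontier (outside (path_image c)) = path_image c"
    using Jordan_inside_outside[of c] by simp_all
  define I Ou where "I = inside (path_image c)" and "Ou = outside (path_image c)"
  note J = J[folded I_def Ou_def]
  define U V where "U = k ` I" and "V = insert p (k ` Ou)"
  have injk: "inj k"
    using hkz by (rule inj_on_inverseI)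
  have khC: "k ` path_image c = ?C"
    unfolding pic image_image using kh sub by force
  have clI: "closure I = I \<union> path_image c"
    using J(9) by (simp add: closure_Un_frontier)
  have oI: "openin (top_of_set S2) U"
  proof -
    have "openin (top_of_set (S2 - {p})) U"
      unfolding U_def
      by (rule homeomorphism_imp_open_map[OF homeomorphism_symD[OF hk]]) (simp add: J)
    moreover have "openin (top_of_set S2) (S2 - {p})"
      by (intro openin_S2_diff) auto
    ultimately show ?thesis using openin_trans by blast
  qed
  have cI: "closed (k ` closure I)"
    using J(5) k by (intro compact_imp_closed compact_continuous_image) auto
  \<comment> \<open>This makes \<open>V\<close> open even at the pole: \<open>closure I\<close> is
    compact in the plane, so its image under \<open>k\<close> is closed in the sphere.\<close>
  have V_eq: "V = S2 - k ` closure I"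
  proof -
    have "Ou = - closure I" using J clI by auto
    then have "k ` Ou = S2 - {p} - k ` closure I"
      using ran injk by (metis Compl_eq_Diff_UNIV image_set_diff)
    then show ?thesis
      using p kin unfolding V_def by blast
  qed
  then have oV: "openin (top_of_set S2) V"
    using openin_S2_diff[OF openin_subtopology_self cI] by simp
  have "k ` I \<inter> k ` path_image c = {}"
  proof -
    have "I \<inter> path_image c = {}" using J by blast
    then show ?thesis using injk by (metis image_Int image_empty)
  qed
  then have UV: "U \<inter> V = {}" "U \<union> V = S2 - ?C"
    using V_eq kin khC unfolding U_def clI image_Un by blast+
  have cU: "connected U"
    unfolding U_def using J k by (intro connected_continuous_image) auto
  \<comment> \<open>If the pole were not a limit of the image of \<open>Ou\<close>, that image would
    have compact closure away from the pole, and \<open>Ou\<close> would be bounded.\<close>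
  have pcl: "p \<in> closure (k ` Ou)"
  proof (rule ccontr)
    assume n: "p \<notin> closure (k ` Ou)"
    have "k ` Ou \<subseteq> S2" using kin by blast
    then have sub': "closure (k ` Ou) \<subseteq> S2 - {p}"
      using n closure_minimal[of "k ` Ou" S2] by auto
    then have "bounded (closure (k ` Ou))"
      using bounded_subset bounded_sphere by blast
    then have "compact (h ` closure (k ` Ou))"
      using sub' by (intro compact_continuous_image continuous_on_subset[OF h])
        (auto simp: compact_eq_bounded_closed)
    moreover have "Ou \<subseteq> h ` closure (k ` Ou)"
    proof
      fix z assume "z \<in> Ou"
      then have "k z \<in> closure (k ` Ou)" using closure_subset[of "k ` Ou"] by auto
      then have "h (k z) \<in> h ` closure (k ` Ou)" by (rule imageI)
      then show "z \<in> h ` closure (k ` Ou)" by (simp only: hkz)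
    qed
    ultimately show False
      using J(6) bounded_subset compact_imp_bounded by blast
  qed
  have "connected (k ` Ou)"
    using J k by (intro connected_continuous_image) auto
  then have cV: "connected V"
    unfolding V_def
    by (rule connected_intermediate_closure) (use pcl closure_subset[of "k ` Ou"] in auto)
  have cl: "?C \<subseteq> closure (k ` A)" if "frontier A = path_image c" for A
  proof -
    have "k ` closure A \<subseteq> closure (k ` A)"
      by (rule image_closure_subset[OF k closed_closure closure_subset])
    moreover have "path_image c \<subseteq> closure A"
      using that by (auto simp: frontier_def)
    ultimately show ?thesis using khC by blast
  qed
  have clU: "?C \<subseteq> closure U"
    unfolding U_def by (rule cl[OF J(9)])
  have clV: "?C \<subseteq> closure V"
    using cl[OF J(10)] closure_mono[of "k ` Ou" V] unfolding V_def by blast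
  show ?thesis
    by (rule that[OF oI oV UV cU cV clU clV])
qed

section \<open>Removing a subset of one component\<close>

lemma in_componentsI:
  assumes "C \<noteq> {}" "C \<subseteq> S" "connected C"
    and "\<And>D. \<lbrakk>connected D; C \<subseteq> D; D \<subseteq> S\<rbrakk> \<Longrightarrow> D \<subseteq> C"
  shows "C \<in> components S"
  unfolding in_components_maximal using assms by (meson subset_antisym)

lemma components_Diff_component:
  assumes W: "W \<in> components U" and A: "A \<subseteq> W"
  shows "components (U - A) = (components U - {W}) \<union> components (W - A)"
proof (intro equalityI subsetI)
  fix C assume C: "C \<in> components (U - A)"
  note C' = in_components_nonempty[OF C] in_components_subset[OF C] in_components_connected[OF C]
  have "\<exists>D. D \<in> components U \<and> C \<subseteq> D"
    using C' by (intro exists_component_superset) auto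
  then obtain D where D: "D \<in> components U" "C \<subseteq> D" by blast
  show "C \<in> (components U - {W}) \<union> components (W - A)"
  proof (cases "D = W")
    case True
    have "C \<in> components (W - A)"
    proof (rule in_componentsI)
      show "C \<subseteq> W - A" using True D C' by blast
      fix E assume E: "connected E" "C \<subseteq> E" "E \<subseteq> W - A"
      have "E \<subseteq> U - A" using E in_components_subset[OF W] by blast
      moreover have "C \<inter> E \<noteq> {}" using E C' by auto
      ultimately show "E \<subseteq> C" using components_maximal[OF C] E by simp
    qed (use C' in auto)
    then show ?thesis by blast
  next
    case False
    then have "D \<inter> W = {}" using D W components_nonoverlap by blast
    then have "D \<subseteq> U - A" using A in_components_subset[OF D(1)] by blast
    moreover have "C \<inter> D \<noteq> {}" using D C' by auto
    ultimately have "D \<subseteq> C"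
      using components_maximal[OF C] in_components_connected[OF D(1)] by simp
    then have "C = D" using D by simp
    then show ?thesis using D False by blast
  qed
next
  fix C assume C: "C \<in> (components U - {W}) \<union> components (W - A)"
  show "C \<in> components (U - A)"
  proof (cases "C \<in> components (W - A)")
    case True
    note C' = in_components_nonempty[OF True] in_components_subset[OF True]
      in_components_connected[OF True]
    show ?thesis
    proof (rule in_componentsI)
      show "C \<subseteq> U - A" using C' in_components_subset[OF W] by blast
      fix D assume D: "connected D" "C \<subseteq> D" "D \<subseteq> U - A"
      have "W \<inter> D \<noteq> {}" using D C' by auto
      then have "D \<subseteq> W"
        using components_maximal[OF W D(1)] D by auto
      then have "D \<subseteq> W - A" using D by auto
      moreover have "C \<inter> D \<noteq> {}" using D C' by auto
      ultimately show "D \<subseteq> C" using components_maximal[OF True D(1)] by simp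
    qed (use C' in auto)
  next
    case False
    then have W': "C \<in> components U" "C \<noteq> W" using C by auto
    note C' = in_components_nonempty[OF W'(1)] in_components_subset[OF W'(1)]
      in_components_connected[OF W'(1)]
    have "C \<inter> W = {}" using W W' components_nonoverlap by blast
    show ?thesis
    proof (rule in_componentsI)
      show "C \<subseteq> U - A" using A C' \<open>C \<inter> W = {}\<close> by auto
      fix D assume D: "connected D" "C \<subseteq> D" "D \<subseteq> U - A"
      have "C \<inter> D \<noteq> {}" "D \<subseteq> U" using D C' by auto
      then show "D \<subseteq> C" using components_maximal[OF W'(1) D(1)] by simp
    qed (use C' in auto)
  qed
qed

text \<open>\<open>W\<close> itself is replaced by the components of \<open>W - A\<close>, which
  accounts for the \<open>+ 1\<close>.\<close>

lemma card_components_Diff_component: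
  assumes W: "W \<in> components U" and A: "A \<subseteq> W"
    and fin: "finite (components U)" "finite (components (W - A))"
  shows "finite (components (U - A))"
    "card (components (U - A)) + 1 = card (components U) + card (components (W - A))"
proof -
  have "(components U - {W}) \<inter> components (W - A) = {}"
  proof (rule ccontr)
    assume "(components U - {W}) \<inter> components (W - A) \<noteq> {}"
    then obtain C where C: "C \<in> components U" "C \<noteq> W" "C \<in> components (W - A)" by auto
    then have "C \<inter> W = {}" using W components_nonoverlap by blast
    then show False
      using C(3) in_components_nonempty in_components_subset by blast
  qed
  then have "card (components (U - A)) = card (components U - {W}) + card (components (W - A))"
    unfolding components_Diff_component[OF W A] using fin by (intro card_Un_disjoint) auto
  moreover have "card (components U) > 0"
    using W fin card_gt_0_iff by blast
  ultimately show "card (components (U - A)) + 1 = card (components U) + card (components (W - A))"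
    using W fin by (simp add: card_Diff_singleton)
  show "finite (components (U - A))"
    unfolding components_Diff_component[OF W A] using fin by simp
qed

section \<open>Adding an arc to a closed subset of the sphere\<close>

lemma openin_component_S2:
  assumes "closed G" "W \<in> components (S2 - G)"
  shows "openin (top_of_set S2) W"
proof -
  have o: "openin (top_of_set S2) (S2 - G)"
    using assms by (intro openin_S2_diff) auto
  then have "locally connected (S2 - G)"
    using locally_open_subset locally_connected_sphere by blast
  then have "openin (top_of_set (S2 - G)) W"
    using assms openin_components_locally_connected by blast
  then show ?thesis using o openin_trans by blast
qed

lemma connected_component_components:
  assumes "W \<in> components U" "x \<in> W" "y \<in> W"
  shows "connected_component U x y"
  using assms in_components_connected in_components_subset
  unfolding connected_component_def by blast

text \<open>An arc by itself separates no two points of the sphere, so of the two separation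
  hypotheses of Janiszewski's theorem only the one about \<open>G\<close> remains.\<close>

lemma Janiszewski_arc:
  assumes G: "compact G" "G \<subseteq> S2" and g: "arc g" "path_image g \<subseteq> S2"
    and int: "connected (G \<inter> path_image g)"
    and cc: "connected_component (S2 - G) x y" and xy: "x \<notin> path_image g" "y \<notin> path_image g"
  shows "connected_component (S2 - (G \<union> path_image g)) x y"
proof (rule Janiszewski_S2[OF G compact_arc_image[OF g(1)] g(2) int cc])
  have "x \<in> S2" "y \<in> S2"
    using cc connected_component_in by fast+
  then show "connected_component (S2 - path_image g) x y"
    using connected_S2_diff_arc[OF g] xy unfolding connected_component_def by blast
qed

lemma arc_interior:
  assumes "arc g"
  shows "path_image g - {pathstart g, pathfinish g} = g ` {0<..<1}"
    "connected (g ` {0<..<1})" "g ` {0<..<1} \<noteq> {}"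
proof -
  have inj: "inj_on g {0..1}" and c: "continuous_on {0..1} g"
    using assms by (auto simp: arc_def path_def)
  have "g ` {0..1} - g ` {0,1} = g ` ({0..1} - {0,1})"
    by (rule inj_on_image_set_diff[OF inj, symmetric]) auto
  moreover have "{0..1} - {0,1} = {0<..<1::real}" by auto
  ultimately show "path_image g - {pathstart g, pathfinish g} = g ` {0<..<1}"
    by (simp add: path_image_def pathstart_def pathfinish_def)
  have "{0<..<1} \<subseteq> {0..1::real}" by auto
  then show "connected (g ` {0<..<1})"
    using continuous_on_subset[OF c] by (intro connected_continuous_image) auto
  show "g ` {0<..<1} \<noteq> {}" by auto
qed

text \<open>The open arc is connected and avoids \<open>G\<close>, hence lies in one component
  \<open>W\<close>. Adding the arc can change the component count only inside
  \<open>W\<close>.\<close>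

lemma component_Diff_arc:
  assumes G: "compact G" "G \<subseteq> S2" and g: "arc g" "path_image g \<subseteq> S2"
    and int: "path_image g \<inter> G = {pathstart g, pathfinish g}"
  obtains W where "W \<in> components (S2 - G)" "openin (top_of_set S2) W" "g ` {0<..<1} \<subseteq> W"
    "S2 - (G \<union> path_image g) = (S2 - G) - g ` {0<..<1}"
    "W - path_image g = W - g ` {0<..<1}"
proof -
  note ai = arc_interior[OF g(1)]
  have sub: "g ` {0<..<1} \<subseteq> S2 - G"
    using ai(1) int g by blast
  have "S2 - G \<noteq> {}" using sub ai(3) by blast
  then obtain W where W: "W \<in> components (S2 - G)" "g ` {0<..<1} \<subseteq> W"
    using exists_component_superset[OF sub _ ai(2)] by blast
  have oW: "openin (top_of_set S2) W"
    using W G by (intro openin_component_S2) (auto intro: compact_imp_closed)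
  have eq: "S2 - (G \<union> path_image g) = (S2 - G) - g ` {0<..<1}"
    unfolding ai(1)[symmetric] using int by auto
  have "W - path_image g = W - g ` {0<..<1}"
    unfolding ai(1)[symmetric] using int in_components_subset[OF W(1)] by auto
  then show ?thesis
    using that[OF W(1) oW W(2) eq] by simp
qed

text \<open>Janiszewski is applied twice, since \<open>g\<close> meets \<open>G1\<close> and then \<open>G1 \<union> g\<close> meets \<open>G2\<close> in one point.\<close>

lemma components_add_arc_join:
  assumes G: "compact G1" "compact G2" "G1 \<subseteq> S2" "G2 \<subseteq> S2" "G1 \<inter> G2 = {}"
    and g: "arc g" "path_image g \<subseteq> S2"
    and int: "path_image g \<inter> G1 = {pathstart g}" "path_image g \<inter> G2 = {pathfinish g}"
    and fin: "finite (components (S2 - (G1 \<union> G2)))"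
  shows "finite (components (S2 - (G1 \<union> G2 \<union> path_image g)))"
    "card (components (S2 - (G1 \<union> G2 \<union> path_image g))) = card (components (S2 - (G1 \<union> G2)))"
proof -
  let ?G = "G1 \<union> G2"
  have cG: "compact ?G" and GS: "?G \<subseteq> S2" using G by auto
  have int': "path_image g \<inter> ?G = {pathstart g, pathfinish g}" using int by auto
  obtain W where W: "W \<in> components (S2 - ?G)" "openin (top_of_set S2) W" "g ` {0<..<1} \<subseteq> W"
      and eq: "S2 - (?G \<union> path_image g) = (S2 - ?G) - g ` {0<..<1}"
      and Wg: "W - path_image g = W - g ` {0<..<1}"
    using component_Diff_arc[OF cG GS g int'] by blast
  have cc: "connected_component (S2 - (?G \<union> path_image g)) x y"
    if "x \<in> W - path_image g" "y \<in> W - path_image g" for x y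
  proof -
    have xy: "connected_component (S2 - ?G) x y"
      using connected_component_components[OF W(1)] that by blast
    have 1: "connected_component (S2 - G1) x y"
      by (rule connected_component_of_subset[OF xy]) auto
    have 2: "connected_component (S2 - G2) x y"
      by (rule connected_component_of_subset[OF xy]) auto
    have 3: "connected_component (S2 - (G1 \<union> path_image g)) x y"
      by (rule Janiszewski_arc[OF G(1,3) g _ 1]) (use int that in \<open>auto simp: Int_commute\<close>)
    have "connected_component (S2 - ((G1 \<union> path_image g) \<union> G2)) x y"
    proof (rule Janiszewski_S2[OF _ _ G(2,4) _ 3 2])
      have "(G1 \<union> path_image g) \<inter> G2 = {pathfinish g}" using int G by auto
      then show "connected ((G1 \<union> path_image g) \<inter> G2)" by simp
    qed (use G g in \<open>auto intro: compact_arc_image\<close>)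
    then show ?thesis by (simp add: Un_ac)
  qed
  \<comment> \<open>\<open>cc\<close> joins the two points by a connected set somewhere in the
    complement; that set avoids \<open>?G\<close> and meets \<open>W\<close>, so it cannot leave
    \<open>W\<close>.\<close>
  have "connected (W - path_image g)"
    unfolding connected_iff_connected_component
  proof (intro ballI)
    fix x y assume xy: "x \<in> W - path_image g" "y \<in> W - path_image g"
    obtain T where T: "connected T" "T \<subseteq> S2 - (?G \<union> path_image g)" "x \<in> T" "y \<in> T"
      using cc[OF xy] unfolding connected_component_def by blast
    have "W \<inter> T \<noteq> {}" "T \<subseteq> S2 - ?G" using T xy by auto
    then have "T \<subseteq> W" using components_maximal[OF W(1) T(1)] by simp
    then have "T \<subseteq> W - path_image g" using T by auto
    then show "connected_component (W - path_image g) x y"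
      using T unfolding connected_component_def by blast
  qed
  moreover have "W - path_image g \<noteq> {}"
    using in_components_nonempty[OF W(1)] W(2) g by (intro S2_open_diff_arc)
  ultimately have c1: "components (W - g ` {0<..<1}) = {W - g ` {0<..<1}}"
    unfolding Wg by (simp add: components_eq_sing_iff)
  show "finite (components (S2 - (?G \<union> path_image g)))"
    unfolding eq using card_components_Diff_component(1)[OF W(1,3) fin] by (simp add: c1)
  have "card (components (S2 - (?G \<union> path_image g))) + 1 = card (components (S2 - ?G)) + 1"
    unfolding eq using card_components_Diff_component(2)[OF W(1,3) fin] by (simp add: c1)
  then show "card (components (S2 - (?G \<union> path_image g))) = card (components (S2 - ?G))"
    by simp
qed

text \<open>Here the arc \<open>b\<close> closes \<open>g\<close> to a Jordan curve meeting \<open>G\<close> exactly in \<open>b\<close>, so by Janiszewski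
  two points are separated by the new arc only if they lie on different sides of this curve.\<close>

lemma components_add_arc_split:
  assumes G: "compact G" "G \<subseteq> S2" and g: "arc g" "path_image g \<subseteq> S2"
    and int: "path_image g \<inter> G = {pathstart g, pathfinish g}"
    and b: "arc b" "path_image b \<subseteq> G" "pathstart b = pathstart g" "pathfinish b = pathfinish g"
    and fin: "finite (components (S2 - G))"
  shows "finite (components (S2 - (G \<union> path_image g)))"
    "card (components (S2 - (G \<union> path_image g))) = card (components (S2 - G)) + 1"
proof -
  obtain W where W: "W \<in> components (S2 - G)" "openin (top_of_set S2) W" "g ` {0<..<1} \<subseteq> W"
      and eq: "S2 - (G \<union> path_image g) = (S2 - G) - g ` {0<..<1}"
      and Wg: "W - path_image g = W - g ` {0<..<1}"
    using component_Diff_arc[OF G g int] by blast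
  have ends: "pathstart g \<in> path_image b" "pathfinish g \<in> path_image b"
    using b(3,4) by (metis pathstart_in_path_image pathfinish_in_path_image)+
  have bS: "path_image b \<subseteq> S2" using b G by auto
  have gb: "path_image g \<inter> path_image b = {pathstart g, pathfinish g}"
    using int b ends pathstart_in_path_image[of g] pathfinish_in_path_image[of g] by auto
  let ?C = "path_image g \<union> path_image b"
  obtain U V where UV: "openin (top_of_set S2) U" "openin (top_of_set S2) V" "U \<inter> V = {}"
    "U \<union> V = S2 - ?C" "connected U" "connected V" "?C \<subseteq> closure U" "?C \<subseteq> closure V"
    using Jordan_S2[OF g b(1) bS b(3,4) gb] by blast
  have cC: "compact ?C" "?C \<subseteq> S2" using compact_arc_image g b bS by auto
  have conn: "connected (W \<inter> A)"
    if A: "connected A" "A = U \<or> A = V" for A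
    unfolding connected_iff_connected_component
  proof (intro ballI)
    fix x y assume xy: "x \<in> W \<inter> A" "y \<in> W \<inter> A"
    have "A \<subseteq> S2 - ?C" using A UV by auto
    then have 1: "connected_component (S2 - ?C) x y"
      using A xy unfolding connected_component_def by blast
    have 2: "connected_component (S2 - G) x y"
      using connected_component_components[OF W(1)] xy by blast
    have "?C \<inter> G = path_image g \<inter> G \<union> path_image b"
      using b(2) by auto
    then have "?C \<inter> G = path_image b"
      using ends by (simp add: int insert_absorb)
    then have "connected (?C \<inter> G)" using connected_arc_image b by simp
    then have "connected_component (S2 - (?C \<union> G)) x y"
      using Janiszewski_S2[OF cC G _ 1 2] by blast
    then obtain T where T: "connected T" "T \<subseteq> S2 - (?C \<union> G)" "x \<in> T" "y \<in> T"
      unfolding connected_component_def by blast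
    have "W \<inter> T \<noteq> {}" "T \<subseteq> S2 - G" using T xy by auto
    then have TW: "T \<subseteq> W" using components_maximal[OF W(1) T(1)] by simp
    have TUV: "T \<subseteq> U \<union> V" using T UV by auto
    have "T \<subseteq> A"
    proof (rule ccontr)
      assume "\<not> T \<subseteq> A"
      then have "U \<inter> T \<noteq> {}" "V \<inter> T \<noteq> {}" using TUV A T xy by auto
      moreover obtain U' V' where "open U'" "U = S2 \<inter> U'" "open V'" "V = S2 \<inter> V'"
        using UV unfolding openin_open by auto
      moreover have "T \<subseteq> S2" using T by auto
      ultimately show False
        using connectedD[OF T(1), of U' V'] TUV UV(3) by blast
    qed
    then show "connected_component (W \<inter> A) x y"
      using T TW unfolding connected_component_def by blast
  qed
  \<comment> \<open>An inner point of \<open>g\<close> lies in the open set \<open>W\<close> and in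
    the closure of both sides of the curve, so both sides really occur in \<open>W\<close>.\<close>
  have ne: "W \<inter> A \<noteq> {}" if "?C \<subseteq> closure A" "A \<subseteq> S2" for A
  proof -
    obtain z where z: "z \<in> g ` {0<..<1}" by fastforce
    have "z \<in> W" "z \<in> closure A"
      using z W(3) that arc_interior(1)[OF g(1)] by auto
    moreover obtain W' where W': "open W'" "W = S2 \<inter> W'"
      using W(2) unfolding openin_open by auto
    ultimately have "W' \<inter> A \<noteq> {}"
      using open_Int_closure_eq_empty[of W' A] by blast
    then show ?thesis using W' that by auto
  qed
  have US: "U \<subseteq> S2" "V \<subseteq> S2" using UV by auto
  have disj: "(W \<inter> U) \<inter> (W \<inter> V) = {}" using UV by auto
  have split: "W - g ` {0<..<1} = (W \<inter> U) \<union> (W \<inter> V)"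
  proof -
    have "W \<inter> path_image b = {}" "W \<subseteq> S2"
      using in_components_subset[OF W(1)] b by auto
    then show ?thesis unfolding Wg[symmetric] using UV by blast
  qed
  have comp: "W \<inter> A \<in> components ((W \<inter> U) \<union> (W \<inter> V))" 
    if "A = U \<or> A = V" for A
  proof (rule in_componentsI)
    show "W \<inter> A \<noteq> {}" using ne that UV US by auto
    show "connected (W \<inter> A)" using conn that UV by auto
    show "W \<inter> A \<subseteq> (W \<inter> U) \<union> (W \<inter> V)" using that by auto
    fix D assume D: "connected D" "W \<inter> A \<subseteq> D" "D \<subseteq> (W \<inter> U) \<union> (W \<inter> V)"
    show "D \<subseteq> W \<inter> A"
    proof (rule ccontr)
      assume "\<not> D \<subseteq> W \<inter> A"
      then have "U \<inter> D \<noteq> {}" "V \<inter> D \<noteq> {}"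
        using D that ne[of U] ne[of V] UV US by blast+
      moreover obtain U' V' where "open U'" "U = S2 \<inter> U'" "open V'" "V = S2 \<inter> V'"
        using UV unfolding openin_open by auto
      moreover have "D \<subseteq> U \<union> V" "D \<subseteq> S2" using D US by auto
      ultimately show False
        using connectedD[OF D(1), of U' V'] UV(3) by blast
    qed
  qed
  have two: "components (W - g ` {0<..<1}) = {W \<inter> U, W \<inter> V}"
  proof -
    have "D \<in> {W \<inter> U, W \<inter> V}" if D: "D \<in> components ((W \<inter> U) \<union> (W \<inter> V))" for D
    proof -
      have "D \<inter> (W \<inter> U) \<noteq> {} \<or> D \<inter> (W \<inter> V) \<noteq> {}"
        using in_components_nonempty[OF D] in_components_subset[OF D] by blast
      then show ?thesis
        using components_eq[OF D comp[of U]] components_eq[OF D comp[of V]] by blast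
    qed
    then show ?thesis unfolding split using comp by blast
  qed
  have "W \<inter> U \<noteq> W \<inter> V"
    using disj ne[OF UV(7) US(1)] by auto
  then have c2: "card (components (W - g ` {0<..<1})) = 2"
    unfolding two by simp
  show "finite (components (S2 - (G \<union> path_image g)))"
    unfolding eq using card_components_Diff_component(1)[OF W(1,3) fin] by (simp add: two)
  have "card (components (S2 - (G \<union> path_image g))) + 1 = card (components (S2 - G)) + 2"
    unfolding eq using card_components_Diff_component(2)[OF W(1,3) fin] c2 two by simp
  then show "card (components (S2 - (G \<union> path_image g))) = card (components (S2 - G)) + 1"
    by simp
qed

section \<open>Rado's theorem for integral weights\<close>

text \<open>A matroid rank function given by one-element axioms. \<open>rank_insert_eq\<close> is
  submodularity in the shape natural for graphs: an element spanned by \<open>S\<close> is spanned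
  by every larger set.\<close>

locale unit_rank =
  fixes I :: "'i set" and r :: "'i set \<Rightarrow> nat"
  assumes finite_ground: "finite I"
    and rank_empty: "r {} = 0"
    and rank_insert_le: "S \<subseteq> I \<Longrightarrow> x \<in> I \<Longrightarrow> r (insert x S) \<le> r S + 1"
    and rank_insert_ge: "S \<subseteq> I \<Longrightarrow> x \<in> I \<Longrightarrow> r S \<le> r (insert x S)"
    and rank_insert_eq:
      "S \<subseteq> T \<Longrightarrow> T \<subseteq> I \<Longrightarrow> x \<in> I \<Longrightarrow> r (insert x S) = r S \<Longrightarrow> r (insert x T) = r T"
begin

text \<open>The elements of \<open>U\<close> are added one at a time; a step that gains nothing over
  \<open>S\<close> gains nothing over \<open>T\<close>. Submodularity is the case in which
  \<open>S\<close> is the intersection of the two sets.\<close>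

lemma rank_diminishing:
  assumes "S \<subseteq> T" "T \<subseteq> I" "U \<subseteq> I"
  shows "r (T \<union> U) + r S \<le> r T + r (S \<union> U)"
proof -
  have "finite U" using assms finite_ground finite_subset by blast
  then show ?thesis using assms(3)
  proof (induction U)
    case (insert x U)
    have x: "x \<in> I" "T \<union> U \<subseteq> I" "S \<union> U \<subseteq> T \<union> U" "S \<union> U \<subseteq> I" using assms insert.prems by auto
    then have "r (insert x (T \<union> U)) + r (S \<union> U) \<le> r (T \<union> U) + r (insert x (S \<union> U))"
      using rank_insert_le[of "T \<union> U" x] rank_insert_ge[of "S \<union> U" x]
        rank_insert_eq[of "S \<union> U" "T \<union> U" x]
      by (cases "r (insert x (S \<union> U)) = r (S \<union> U)") auto
    then show ?case using insert by simp
  qed simp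
qed

lemma rank_mono:
  assumes "S \<subseteq> T" "T \<subseteq> I"
  shows "r S \<le> r T"
proof -
  have "finite (T - S)" using assms finite_ground by (meson finite_Diff finite_subset)
  moreover have "r S \<le> r (S \<union> U)" if "finite U" "U \<subseteq> I" for U
    using that
  proof (induction U)
    case (insert x U)
    moreover have "S \<union> U \<subseteq> I" "x \<in> I" using insert.prems assms by auto
    ultimately show ?case
      using rank_insert_ge[of "S \<union> U" x] by simp
  qed simp
  ultimately have "r S \<le> r (S \<union> (T - S))" using assms by blast
  then show ?thesis using assms by (simp add: Un_absorb1)
qed

lemma rank_submodular:
  assumes "A \<subseteq> I" "B \<subseteq> I"
  shows "r (A \<union> B) + r (A \<inter> B) \<le> r A + r B"
  using rank_diminishing[of "A \<inter> B" B A] assms by (simp add: Un_commute Un_absorb1)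

lemma rank_le_card:
  assumes "S \<subseteq> I"
  shows "r S \<le> card S"
proof -
  have "finite S" using assms finite_ground finite_subset by blast
  then show ?thesis using assms
  proof (induction S)
    case (insert x S)
    then show ?case using rank_insert_le[of S x] by auto
  qed (simp add: rank_empty)
qed

text \<open>By the contrapositive of \<open>rank_insert_eq\<close>, a bridge of \<open>S\<close>
  remains a bridge in every subset of \<open>S\<close> containing it, so each deletion costs
  one.\<close>

lemma rank_remove_bridges:
  assumes "S \<subseteq> I" "D \<subseteq> S" and bridge: "\<And>x. x \<in> D \<Longrightarrow> r (S - {x}) < r S"
  shows "r (S - D) + card D \<le> r S"
proof -
  have "finite D" using assms(1,2) finite_ground by (meson finite_subset)
  then show ?thesis using assms(2) bridge
  proof (induction D)
    case (insert x D)
    have eq: "insert x (S - insert x D) = S - D" "insert x (S - {x}) = S"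
      using insert.hyps insert.prems(1) by auto
    have "r (S - insert x D) < r (S - D)"
    proof (rule ccontr)
      assume "\<not> ?thesis"
      moreover have sub: "S - insert x D \<subseteq> I" "S - {x} \<subseteq> I" "x \<in> I"
        using assms(1) insert.prems(1) by auto
      ultimately have *: "r (insert x (S - insert x D)) = r (S - insert x D)"
        using rank_insert_ge[OF sub(1,3)] unfolding eq(1) by linarith
      have "r (insert x (S - {x})) = r (S - {x})"
        by (rule rank_insert_eq[OF _ sub(2,3) *]) auto
      then show False using insert.prems(2)[of x] unfolding eq(2) by simp
    qed
    moreover have "r (S - D) + card D \<le> r S"
      using insert.IH insert.prems by blast
    ultimately show ?case using insert.hyps by simp
  qed simp
qed

text \<open>A minimal set satisfying the rank condition is the required one. If it had too many elements
  over \<open>e\<close>, each of them would be a bridge over some tight set containing \<open>e\<close>; the tight sets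
  are closed under intersection, and over the intersection \<open>D\<close> of these sets the removal of all
  the bridges violates the condition for \<open>D - {e}\<close>.\<close>

theorem Rado:
  assumes "finite E" and p: "p ` I \<subseteq> E"
    and h: "\<And>A. A \<subseteq> E \<Longrightarrow> (\<Sum>e\<in>A. h e) \<le> r {i \<in> I. p i \<in> A}"
  obtains T where "T \<subseteq> I" "r T = card T" "\<And>e. e \<in> E \<Longrightarrow> card {i \<in> T. p i = e} = h e"
proof -
  define P where "P T \<longleftrightarrow> T \<subseteq> I \<and> (\<forall>A\<subseteq>E. (\<Sum>e\<in>A. h e) \<le> r {i \<in> T. p i \<in> A})" for T
  have "P I" using h by (simp add: P_def)
  then obtain T where T: "P T" and min: "\<And>T'. P T' \<Longrightarrow> card T \<le> card T'"
    using arg_min_nat_lemma[of P I card] by blast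
  define R where "R A = {i \<in> T. p i \<in> A}" for A
  have TI: "T \<subseteq> I" and le: "\<And>A. A \<subseteq> E \<Longrightarrow> sum h A \<le> r (R A)"
    using T unfolding P_def R_def by auto
  have finT: "finite T" using TI finite_ground finite_subset by blast
  have RI: "R A \<subseteq> I" for A using TI by (auto simp: R_def)
  have eq: "card (R {e}) = h e" if e: "e \<in> E" for e
  proof (rule ccontr)
    assume ne: "card (R {e}) \<noteq> h e"
    have "h e \<le> card (R {e})"
      using le[of "{e}"] rank_le_card[OF RI, of "{e}"] e by simp
    then have gt: "h e < card (R {e})" using ne by simp
    \<comment> \<open>By minimality, deleting \<open>x\<close> breaks the condition for some
      \<open>A\<close>, which must contain \<open>e\<close>. Since one element changes the rank by
      at most one, the condition held with equality at \<open>A\<close>.\<close>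
    have "\<exists>A\<subseteq>E. e \<in> A \<and> r (R A) = sum h A \<and> r (R A - {x}) < r (R A)" if x: "x \<in> R {e}" for x
    proof -
      have "card (T - {x}) < card T"
        using x finT by (intro psubset_card_mono) (auto simp: R_def)
      then have "\<not> P (T - {x})" using min leD by blast
      then obtain A where A: "A \<subseteq> E" "r {i \<in> T - {x}. p i \<in> A} < sum h A"
        using TI unfolding P_def by (auto simp: not_le)
      have R': "{i \<in> T - {x}. p i \<in> A} = R A - {x}" by (auto simp: R_def)
      have xA: "x \<in> R A"
      proof (rule ccontr)
        assume "x \<notin> R A"
        then have "R A - {x} = R A" by auto
        then show False using A le[OF A(1)] R' by simp
      qed
      then have "insert x (R A - {x}) = R A" by auto
      then have "r (R A) \<le> r (R A - {x}) + 1"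
        using rank_insert_le[of "R A - {x}" x] RI[of A] xA by auto
      then have "r (R A) = sum h A" "r (R A - {x}) < r (R A)"
        using A R' le[OF A(1)] by auto
      moreover have "e \<in> A" using xA x by (auto simp: R_def)
      ultimately show ?thesis using A by blast
    qed
    then obtain A where A: "\<And>x. x \<in> R {e} \<Longrightarrow> A x \<subseteq> E"
       "\<And>x. x \<in> R {e} \<Longrightarrow> e \<in> A x" "\<And>x. x \<in> R {e} \<Longrightarrow> r (R (A x)) = sum h (A x)"
       "\<And>x. x \<in> R {e} \<Longrightarrow> r (R (A x) - {x}) < r (R (A x))"
      by metis
    have finR: "finite (R {e})" using finT by (auto simp: R_def)
    \<comment> \<open>\<open>sum h\<close> is modular and never exceeds the rank, so submodularity
      forces equality at both the union and the intersection of two tight sets.\<close>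
    have tight: "r (R (\<Inter>(A ` Y))) = sum h (\<Inter>(A ` Y))"
      if "finite Y" "Y \<noteq> {}" "Y \<subseteq> R {e}" for Y
      using that
    proof (induction Y rule: finite_ne_induct)
      case (singleton x)
      then show ?case using A(3) by simp
    next
      case (insert x Y)
      define B where "B = \<Inter>(A ` Y)"
      have B: "B \<subseteq> E" "A x \<subseteq> E" using A(1) insert by (auto simp: B_def)
      have R_Int: "R (A x \<inter> B) = R (A x) \<inter> R B" and R_Un: "R (A x \<union> B) = R (A x) \<union> R B"
        by (auto simp: R_def)
      have finB: "finite B" "finite (A x)" using B \<open>finite E\<close> finite_subset by blast+
      have "r (R (A x \<union> B)) + r (R (A x \<inter> B)) \<le> r (R (A x)) + r (R B)"
        unfolding R_Int R_Un by (rule rank_submodular[OF RI RI])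
      also have "\<dots> = sum h (A x) + sum h B"
        using insert A(3) by (simp add: B_def)
      also have "\<dots> = sum h (A x \<union> B) + sum h (A x \<inter> B)"
        using sum.union_inter[OF finB(2,1), of h] by simp
      finally have "r (R (A x \<inter> B)) = sum h (A x \<inter> B)"
        using le[of "A x \<union> B"] le[of "A x \<inter> B"] B by fastforce
      then show ?case by (simp add: B_def)
    qed
    define D where "D = \<Inter>(A ` R {e})"
    have "card (R {e}) > 0" using gt by simp
    then have ne: "R {e} \<noteq> {}" by auto
    have Dt: "r (R D) = sum h D" unfolding D_def using tight[OF finR ne] by simp
    have DE: "D \<subseteq> E" "e \<in> D" using A(1,2) ne by (auto simp: D_def)
    have "r (R D - {x}) < r (R D)" if x: "x \<in> R {e}" for x
    proof (rule ccontr)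
      assume n: "\<not> ?thesis"
      have sub: "R D \<subseteq> R (A x)" using x by (auto simp: R_def D_def)
      have xD: "x \<in> R D" using x DE by (auto simp: R_def)
      then have i: "insert x (R D - {x}) = R D" "insert x (R (A x) - {x}) = R (A x)"
        using sub by auto
      have xI: "x \<in> I" using xD RI by auto
      have "r (R D - {x}) \<le> r (R D)"
        by (rule rank_mono[OF _ RI]) auto
      then have *: "r (insert x (R D - {x})) = r (R D - {x})"
        using n unfolding i by simp
      have "r (insert x (R (A x) - {x})) = r (R (A x) - {x})"
        by (rule rank_insert_eq[OF _ _ xI *]) (use sub RI[of "A x"] in auto)
      then show False using A(4)[OF x] i by simp
    qed
    then have "r (R D - R {e}) + card (R {e}) \<le> r (R D)"
      using DE by (intro rank_remove_bridges RI) (auto simp: R_def)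
    moreover have "R D - R {e} = R (D - {e})" by (auto simp: R_def)
    moreover have "sum h D = sum h (D - {e}) + h e"
      using DE \<open>finite E\<close> by (metis add.commute finite_subset sum.remove)
    ultimately show False using gt Dt le[of "D - {e}"] DE by fastforce
  qed
  \<comment> \<open>With all counts correct, \<open>T\<close> has \<open>sum h E\<close> elements,
    which is at most its rank; hence \<open>T\<close> is independent.\<close>
  have "card T = (\<Sum>e\<in>E. card (R {e}))"
  proof -
    have "T = (\<Union>e\<in>E. R {e})" using TI p by (auto simp: R_def)
    moreover have "card (\<Union>e\<in>E. R {e}) = (\<Sum>e\<in>E. card (R {e}))"
      using \<open>finite E\<close> finT by (intro card_UN_disjoint) (auto simp: R_def)
    ultimately show ?thesis by simp
  qed
  then have "card T = sum h E" using eq by simp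
  moreover have "R E = T" using TI p by (auto simp: R_def)
  ultimately have "r T = card T"
    using le[of E] rank_le_card[OF TI] by simp
  moreover have "R {e} = {i \<in> T. p i = e}" for e by (auto simp: R_def)
  ultimately show ?thesis using that TI eq by metis
qed

end

section \<open>The rank function of a finite graph\<close>

text \<open>Adjacency depends on the edges alone, so the vertex set is fixed to the empty one and
  reachability can be compared across graphs with different vertex sets.\<close>

definition reach :: "'a set set \<Rightarrow> ('a \<times> 'a) set" where
  "reach S = (ugraph_adj ({}, S))\<^sup>*"

lemma ugraph_adj_rtrancl: "(ugraph_adj (X, S))\<^sup>* = reach S"
  by (simp add: reach_def ugraph_adj_def)

lemma reach_refl [simp]: "(x, x) \<in> reach S"
  by (simp add: reach_def)

lemma reach_trans: "(x, y) \<in> reach S \<Longrightarrow> (y, z) \<in> reach S \<Longrightarrow> (x, z) \<in> reach S"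
  unfolding reach_def by (rule rtrancl_trans)

lemma reach_edge: "{x, y} \<in> S \<Longrightarrow> (x, y) \<in> reach S"
  by (auto simp: reach_def ugraph_adj_def)

lemma reach_induct [consumes 1, case_names base step]:
  assumes "(a, b) \<in> reach S" "P a"
    "\<And>y z. \<lbrakk>(a, y) \<in> reach S; {y, z} \<in> S; P y\<rbrakk> \<Longrightarrow> P z"
  shows "P b"
  using assms(1) unfolding reach_def
  by (induction rule: rtrancl_induct) (use assms(2,3) in \<open>auto simp: reach_def ugraph_adj_def\<close>)

lemma reach_sym:
  assumes "(x, y) \<in> reach S"
  shows "(y, x) \<in> reach S"
  using assms
proof (induction rule: reach_induct)
  case (step y z)
  then have "(z, y) \<in> reach S" by (intro reach_edge) (simp add: insert_commute)
  then show ?case using step.IH by (rule reach_trans)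
qed simp

lemma reach_mono:
  assumes "(x, y) \<in> reach S" "S \<subseteq> T"
  shows "(x, y) \<in> reach T"
  using assms(1)
proof (induction rule: reach_induct)
  case (step y z)
  then have "(y, z) \<in> reach T" using assms(2) by (intro reach_edge) auto
  with step.IH show ?case by (rule reach_trans)
qed simp

lemma reach_insert:
  "(x, y) \<in> reach (insert {a, b} S) \<longleftrightarrow>
     (x, y) \<in> reach S \<or> (x, a) \<in> reach S \<and> (b, y) \<in> reach S \<or> (x, b) \<in> reach S \<and> (a, y) \<in> reach S"
  (is "?L \<longleftrightarrow> ?R")
proof
  assume ?L
  then show ?R
  proof (induction rule: reach_induct)
    case (step y z)
    consider "{y, z} \<in> S" | "y = a" "z = b" | "y = b" "z = a"
      using step(2) by (auto simp: doubleton_eq_iff)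
    then show ?case
    proof cases
      case 1
      then show ?thesis using step.IH reach_edge[OF 1] by (meson reach_trans)
    next
      case 2
      then show ?thesis using step.IH by (metis reach_refl)
    next
      case 3
      then show ?thesis using step.IH by (metis reach_refl)
    qed
  qed simp
next
  have m: "(u, v) \<in> reach S \<Longrightarrow> (u, v) \<in> reach (insert {a, b} S)" for u v
    by (erule reach_mono) auto
  have ab: "(a, b) \<in> reach (insert {a, b} S)" "(b, a) \<in> reach (insert {a, b} S)"
    by (auto intro!: reach_edge)
  assume ?R
  then show ?L using m ab by (meson reach_trans)
qed

definition ncomp :: "'a set \<Rightarrow> 'a set set \<Rightarrow> nat" where
  "ncomp X S = card (ugraph_components (X, S))"

definition cls :: "'a set \<Rightarrow> 'a set set \<Rightarrow> 'a \<Rightarrow> 'a set" where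
  "cls X S x = {y \<in> X. (x, y) \<in> reach S}"

lemma ugraph_components_cls: "ugraph_components (X, S) = cls X S ` X"
  by (auto simp: ugraph_components_def ugraph_adj_rtrancl quotient_def cls_def image_iff Image_def)

lemma cls_eq_iff: "x \<in> X \<Longrightarrow> y \<in> X \<Longrightarrow> cls X S x = cls X S y \<longleftrightarrow> (x, y) \<in> reach S"
  unfolding cls_def set_eq_iff mem_Collect_eq
  by (meson reach_sym reach_refl reach_trans)

lemma ncomp_le: "finite X \<Longrightarrow> ncomp X S \<le> card X"
  unfolding ncomp_def ugraph_components_cls by (rule card_image_le)

lemma ncomp_empty: "ncomp X {} = card X"
proof -
  have "cls X {} x = {x}" if "x \<in> X" for x
    using that by (auto simp: cls_def reach_def ugraph_adj_def)
  then have "cls X {} ` X = (\<lambda>x. {x}) ` X" by (intro image_cong) auto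
  then show ?thesis
    unfolding ncomp_def ugraph_components_cls by (simp add: card_image)
qed

lemma ncomp_insert_reach:
  assumes "(a, b) \<in> reach S"
  shows "ncomp X (insert {a, b} S) = ncomp X S"
proof -
  have "(x, y) \<in> reach (insert {a, b} S) \<longleftrightarrow> (x, y) \<in> reach S" for x y
    unfolding reach_insert using assms reach_sym[OF assms] by (meson reach_trans)
  then show ?thesis
    by (simp add: ncomp_def ugraph_components_cls cls_def)
qed

text \<open>The classes of \<open>a\<close> and \<open>b\<close> fuse into \<open>?M\<close>, and no
  other class changes.\<close>

lemma ncomp_insert_not_reach:
  assumes X: "finite X" "a \<in> X" "b \<in> X" and ab: "(a, b) \<notin> reach S"
  shows "ncomp X (insert {a, b} S) + 1 = ncomp X S"
proof -
  let ?C = "cls X S" and ?M = "cls X S a \<union> cls X S b"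
  have new: "cls X (insert {a, b} S) x = (if x \<in> ?M then ?M else ?C x)" if "x \<in> X" for x
    using that unfolding cls_def reach_insert
    by (auto dest: reach_sym intro: reach_trans)
  have inM: "x \<in> ?M \<longleftrightarrow> ?C x = ?C a \<or> ?C x = ?C b" if "x \<in> X" for x
    using that X by (auto simp: cls_eq_iff) (auto simp: cls_def intro: reach_sym)
  have "cls X (insert {a, b} S) ` X = insert ?M (?C ` X - {?C a, ?C b})"
  proof
    show "cls X (insert {a, b} S) ` X \<subseteq> insert ?M (?C ` X - {?C a, ?C b})"
      using new inM by auto
    have "a \<in> ?M" using X by (auto simp: cls_def)
    then have "?M \<in> cls X (insert {a, b} S) ` X"
      by (intro image_eqI[OF _ X(2)]) (simp only: new[OF X(2)] if_True)
    moreover have "?C x \<in> cls X (insert {a, b} S) ` X"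
      if "x \<in> X" "?C x \<noteq> ?C a" "?C x \<noteq> ?C b" for x
      using new[of x] inM[of x] that by (intro image_eqI[OF _ that(1)]) simp
    ultimately show "insert ?M (?C ` X - {?C a, ?C b}) \<subseteq> cls X (insert {a, b} S) ` X" by auto
  qed
  \<comment> \<open>An old class equal to \<open>?M\<close> would already connect \<open>a\<close>
    with \<open>b\<close>. So two classes disappear and a genuinely new one is added.\<close>
  moreover have "?M \<notin> ?C ` X"
  proof
    assume "?M \<in> ?C ` X"
    then obtain x where x: "x \<in> X" "?M = ?C x" by auto
    have "a \<in> ?M" "b \<in> ?M" using X by (auto simp: cls_def)
    then have "a \<in> ?C x" "b \<in> ?C x" unfolding x(2) .
    then have "(x, a) \<in> reach S" "(x, b) \<in> reach S" by (simp_all add: cls_def)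
    from reach_trans[OF reach_sym[OF this(1)] this(2)] ab show False by simp
  qed
  moreover have "?C a \<noteq> ?C b" using ab X by (simp add: cls_eq_iff)
  moreover have "card (?C ` X - {?C a, ?C b}) + 2 = card (?C ` X)"
  proof -
    have "card {?C a, ?C b} \<le> card (?C ` X)" using X by (intro card_mono) auto
    moreover have "card (?C ` X - {?C a, ?C b}) = card (?C ` X) - card {?C a, ?C b}"
      using X by (intro card_Diff_subset) auto
    ultimately show ?thesis using \<open>?C a \<noteq> ?C b\<close> by simp
  qed
  ultimately show ?thesis
    using X unfolding ncomp_def ugraph_components_cls by simp
qed

text \<open>The rank in the cycle matroid, i.e. the size of a spanning forest. By
  \<open>ncomp_le\<close> the truncated subtraction is exact for finite \<open>X\<close>.\<close>

definition rk :: "'a set \<Rightarrow> 'a set set \<Rightarrow> nat" where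
  "rk X S = card X - ncomp X S"

lemma rk_insert:
  assumes "finite X" "a \<in> X" "b \<in> X"
  shows "rk X (insert {a, b} S) = rk X S + (if (a, b) \<in> reach S then 0 else 1)"
  using ncomp_insert_reach[of a b S X] ncomp_insert_not_reach[of X a b S] assms
    ncomp_le[of X S] ncomp_le[of X "insert {a, b} S"]
  by (auto simp: rk_def)

text \<open>An edge adds nothing to the rank exactly when its ends are already connected, and
  connectedness is preserved by adding edges.\<close>

lemma unit_rank_rk:
  assumes X: "finite X" and I: "finite I"
    and ends: "\<And>i. i \<in> I \<Longrightarrow> \<exists>a\<in>X. \<exists>b\<in>X. m i = {a, b}"
  shows "unit_rank I (\<lambda>S. rk X (m ` S))"
proof
  show "finite I" by fact
  show "rk X (m ` {}) = 0" by (simp add: rk_def ncomp_empty)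
next
  fix S x assume "S \<subseteq> I" "x \<in> I"
  then obtain a b where "a \<in> X" "b \<in> X" "m x = {a, b}" using ends by blast
  then show "rk X (m ` insert x S) \<le> rk X (m ` S) + 1" "rk X (m ` S) \<le> rk X (m ` insert x S)"
    using rk_insert[OF X, of a b] by auto
next
  fix S T x assume ST: "S \<subseteq> T" "T \<subseteq> I" "x \<in> I" and eq: "rk X (m ` insert x S) = rk X (m ` S)"
  obtain a b where ab: "a \<in> X" "b \<in> X" "m x = {a, b}" using ends ST by blast
  then have "(a, b) \<in> reach (m ` S)"
    using rk_insert[OF X ab(1,2), of "m ` S"] eq by (auto split: if_splits)
  then have "(a, b) \<in> reach (m ` T)"
    by (rule reach_mono) (use ST in auto)
  then show "rk X (m ` insert x T) = rk X (m ` T)"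
    using rk_insert[OF X ab(1,2), of "m ` T"] ab by auto
qed

section \<open>Forests and cycles\<close>

lemma ugraph_connected_iff_ncomp:
  assumes "finite X" "X \<noteq> {}"
  shows "ugraph_connected (X, S) \<longleftrightarrow> ncomp X S = 1"
proof -
  have "ugraph_connected (X, S) \<longleftrightarrow> (\<forall>x\<in>X. \<forall>y\<in>X. cls X S x = cls X S y)"
    using assms by (auto simp: ugraph_connected_def ugraph_adj_rtrancl cls_eq_iff)
  also have "\<dots> \<longleftrightarrow> (\<exists>C. cls X S ` X = {C})"
    using assms(2) by (auto simp: image_iff set_eq_iff[of "_ ` _"]) (metis, blast)
  finally show ?thesis
    unfolding ncomp_def ugraph_components_cls using card_1_singleton_iff by (simp add: card_1_singleton_iff)
qed

lemma reach_simple_path: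
  assumes "(a, b) \<in> reach S"
  obtains xs where "xs \<noteq> []" "distinct xs" "hd xs = a" "last xs = b"
    "\<And>i. Suc i < length xs \<Longrightarrow> {xs ! i, xs ! Suc i} \<in> S"
proof -
  have "\<exists>xs. xs \<noteq> [] \<and> distinct xs \<and> hd xs = a \<and> last xs = b \<and>
     (\<forall>i. Suc i < length xs \<longrightarrow> {xs ! i, xs ! Suc i} \<in> S)"
    using assms
  proof (induction rule: reach_induct)
    case base
    show ?case by (intro exI[of _ "[a]"]) auto
  next
    case (step y z)
    then obtain xs where xs: "xs \<noteq> []" "distinct xs" "hd xs = a" "last xs = y"
       "\<forall>i. Suc i < length xs \<longrightarrow> {xs ! i, xs ! Suc i} \<in> S" by auto
    show ?case
    proof (cases "z \<in> set xs")
      case True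
      then obtain j where j: "j < length xs" "xs ! j = z" by (auto simp: in_set_conv_nth)
      show ?thesis
      proof (intro exI[of _ "take (Suc j) xs"] conjI)
        show "last (take (Suc j) xs) = z" using j by (simp add: take_Suc_conv_app_nth)
      qed (use xs j in \<open>auto simp: hd_take\<close>)
    next
      case False
      show ?thesis
      proof (intro exI[of _ "xs @ [z]"] conjI allI impI)
        fix i assume i: "Suc i < length (xs @ [z])"
        show "{(xs @ [z]) ! i, (xs @ [z]) ! Suc i} \<in> S"
        proof (cases "Suc i < length xs")
          case True
          then show ?thesis using xs by (simp add: nth_append)
        next
          case False
          then have "i = length xs - 1" "Suc i = length xs" using i by auto
          then show ?thesis using xs step(2) by (simp add: nth_append last_conv_nth)
        qed
      qed (use xs False in auto)
    qed
  qed
  then show ?thesis using that by blast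
qed

text \<open>Edges are added one at a time. If the ends of a new edge were already connected, a
  simple path between them would close to a cycle; it has at least three vertices because the ends
  differ and the edge is new.\<close>

lemma acyclic_rk:
  assumes X: "finite X" and "finite S"
    and ends: "\<And>t. t \<in> S \<Longrightarrow> \<exists>a\<in>X. \<exists>b\<in>X. a \<noteq> b \<and> t = {a, b}"
    and "\<nexists>xs. ugraph_cycle (X, S) xs"
  shows "rk X S = card S"
  using \<open>finite S\<close> ends assms(4)
proof (induction S)
  case empty
  then show ?case by (simp add: rk_def ncomp_empty)
next
  case (insert t S)
  obtain a b where ab: "a \<in> X" "b \<in> X" "a \<noteq> b" "t = {a, b}" using insert.prems(1)[of t] by auto
  have IH: "rk X S = card S"
    using insert.IH insert.prems by (auto simp: ugraph_cycle_def ugraph_adj_def)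
  have "(a, b) \<notin> reach S"
  proof
    assume "(a, b) \<in> reach S"
    then obtain xs where xs: "xs \<noteq> []" "distinct xs" "hd xs = a" "last xs = b"
      "\<And>i. Suc i < length xs \<Longrightarrow> {xs ! i, xs ! Suc i} \<in> S"
      using reach_simple_path by metis
    have "length xs \<noteq> 1" using xs ab by (auto simp: length_Suc_conv)
    moreover have "length xs \<noteq> 2"
    proof
      assume l: "length xs = 2"
      then have "{xs ! 0, xs ! 1} \<in> S" using xs(5)[of 0] by simp
      moreover have "xs ! 0 = a" "xs ! 1 = b" using xs l by (auto simp: hd_conv_nth last_conv_nth)
      ultimately show False using ab insert.hyps by simp
    qed
    moreover have "length xs \<noteq> 0" using xs by simp
    ultimately have len: "3 \<le> length xs" by linarith
    have "{xs ! i, xs ! (Suc i mod length xs)} \<in> insert t S" if i: "i < length xs" for i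
    proof (cases "Suc i < length xs")
      case True
      then show ?thesis using xs(5)[OF True] by simp
    next
      case False
      then have "Suc i = length xs" using i by simp
      moreover have "xs ! i = b" using xs calculation by (metis diff_Suc_1 last_conv_nth)
      moreover have "xs ! 0 = a" using xs by (simp add: hd_conv_nth)
      ultimately show ?thesis using ab by (simp add: insert_commute)
    qed
    then have "ugraph_cycle (X, insert t S) xs"
      using len xs by (simp add: ugraph_cycle_def ugraph_adj_def)
    then show False using insert.prems(2) by blast
  qed
  then show ?case
    using rk_insert[OF X ab(1,2), of S] IH ab insert.hyps by simp
qed

lemma rk_le_card:
  assumes "finite X" "finite S" and ends: "\<And>t. t \<in> S \<Longrightarrow> \<exists>a\<in>X. \<exists>b\<in>X. t = {a, b}"
  shows "rk X S \<le> card S"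
proof -
  interpret unit_rank S "\<lambda>S. rk X (id ` S)"
    using assms by (intro unit_rank_rk) auto
  show ?thesis using rank_le_card[of S] by simp
qed

text \<open>The rest of a cycle connects the ends of its edge \<open>?t\<close>, so deleting
  \<open>?t\<close> lowers the cardinality but not the rank.\<close>

lemma rk_eq_card_acyclic:
  assumes X: "finite X" and "finite S"
    and ends: "\<And>t. t \<in> S \<Longrightarrow> \<exists>a\<in>X. \<exists>b\<in>X. t = {a, b}"
    and rk: "rk X S = card S"
  shows "\<not> ugraph_cycle (X, S) xs"
proof
  assume c: "ugraph_cycle (X, S) xs"
  then have len: "3 \<le> length xs" and d: "distinct xs"
    and adj: "\<And>i. i < length xs \<Longrightarrow> {xs ! i, xs ! (Suc i mod length xs)} \<in> S"
    by (auto simp: ugraph_cycle_def ugraph_adj_def)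
  let ?n = "length xs" and ?t = "{xs ! 0, xs ! 1}"
  have n: "0 < ?n" "1 < ?n" "2 < ?n" using len by linarith+
  then have t: "?t \<in> S" using adj[of 0] by simp
  have 0: "xs ! 0 \<in> X" "xs ! 1 \<in> X" using ends[OF t] by (auto simp: doubleton_eq_iff)
  \<comment> \<open>Here a length of at least three matters: in a closed walk of length two the
    return edge would be \<open>?t\<close> itself.\<close>
  have edge: "{xs ! i, xs ! (Suc i mod ?n)} \<in> S - {?t}" if "0 < i" "i < ?n" for i
  proof -
    have "xs ! i \<noteq> xs ! 0"
      using nth_eq_iff_index_eq[OF d that(2) n(1)] that by simp
    moreover have "xs ! (Suc i mod ?n) \<noteq> xs ! 0 \<or> xs ! i \<noteq> xs ! 1"
    proof (cases "i = 1")
      case True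
      then have "xs ! (Suc i mod ?n) \<noteq> xs ! 0"
        using nth_eq_iff_index_eq[OF d n(3,1)] n by (simp add: numeral_2_eq_2)
      then show ?thesis by simp
    next
      case False
      then show ?thesis
        using nth_eq_iff_index_eq[OF d that(2) n(2)] by simp
    qed
    ultimately show ?thesis using adj[OF that(2)] by (auto simp: doubleton_eq_iff)
  qed
  have "(xs ! 1, xs ! i) \<in> reach (S - {?t})" if "1 \<le> i" "i < ?n" for i
    using that
  proof (induction i rule: dec_induct)
    case (step i)
    have "{xs ! i, xs ! Suc i} \<in> S - {?t}" using edge[of i] step by auto
    moreover have "(xs ! 1, xs ! i) \<in> reach (S - {?t})" using step by simp
    ultimately show ?case
      by (metis reach_edge reach_trans)
  qed simp
  then have "(xs ! 1, xs ! (?n - 1)) \<in> reach (S - {?t})" using len by simp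
  moreover have "{xs ! (?n - 1), xs ! 0} \<in> S - {?t}"
  proof -
    have "Suc (?n - 1) = ?n" "0 < ?n - 1" "?n - 1 < ?n" using len by linarith+
    moreover from this(1) have "Suc (?n - 1) mod ?n = 0" by (simp only: mod_self)
    ultimately show ?thesis using edge[of "?n - 1"] by metis
  qed
  ultimately have "(xs ! 1, xs ! 0) \<in> reach (S - {?t})"
    by (metis reach_edge reach_trans)
  from reach_sym[OF this] have "rk X (insert ?t (S - {?t})) = rk X (S - {?t})"
    by (simp only: rk_insert[OF X 0] if_True add_0_right)
  then have "rk X S = rk X (S - {?t})" using t by (simp add: insert_absorb)
  also have "\<dots> \<le> card (S - {?t})"
    using assms by (intro rk_le_card) auto
  also have "\<dots> < card S" using t \<open>finite S\<close> by (intro psubset_card_mono) auto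
  finally show False using rk by simp
qed

text \<open>No edge meets a vertex outside \<open>X'\<close>, so each such vertex is a component of
  its own. This compares restricted hypergraphs with full ones and splits off isolated hyperedges in
  the dual.\<close>

lemma ncomp_extend:
  assumes "finite X" "X' \<subseteq> X" and S: "\<And>t. t \<in> S \<Longrightarrow> t \<subseteq> X'"
  shows "ncomp X S = ncomp X' S + card (X - X')"
proof -
  have stay: "y \<in> X' \<or> y = x" if "(x, y) \<in> reach S" for x y
    using that by (induction rule: reach_induct) (use S in auto)
  have 1: "cls X S x = {x}" if "x \<in> X - X'" for x
    using that stay[of _ x] assms(2) reach_sym[of x _ S] by (fastforce simp: cls_def)
  have 2: "cls X S x = cls X' S x" if "x \<in> X'" for x
    using that stay[of x] assms(2) by (auto simp: cls_def)
  have "cls X S ` X = cls X' S ` X' \<union> (\<lambda>x. {x}) ` (X - X')"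
  proof -
    have "X = X' \<union> (X - X')" using assms by auto
    then have "cls X S ` X = cls X S ` X' \<union> cls X S ` (X - X')" by (metis image_Un)
    then show ?thesis using 1 2 by (metis (no_types, lifting) image_cong)
  qed
  moreover have "cls X' S ` X' \<inter> (\<lambda>x. {x}) ` (X - X') = {}"
    by (auto simp: cls_def)
  ultimately show ?thesis
    unfolding ncomp_def ugraph_components_cls
    using assms finite_subset[OF assms(2,1)]
    by (simp add: card_Un_disjoint card_image)
qed

section \<open>Hypertrees as integer points of the polytope\<close>

definition bedge :: "'v \<times> 'e \<Rightarrow> ('v + 'e) set" where
  "bedge i = {Inl (fst i), Inr (snd i)}"

definition bverts :: "('v, 'e) hypergraph \<Rightarrow> ('v + 'e) set" where
  "bverts H = hverts H <+> hedges H"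

definition incidences_at :: "('v, 'e) hypergraph \<Rightarrow> 'e set \<Rightarrow> ('v \<times> 'e) set" where
  "incidences_at H A = {i \<in> incidences H. snd i \<in> A}"

text \<open>The rank is taken over all nodes of the bipartite graph. Isolated nodes contribute
  equally to the node count and to the component count, so the value agrees with that of the
  restricted hypergraph.\<close>

definition hrank :: "('v, 'e) hypergraph \<Rightarrow> 'e set \<Rightarrow> nat" where
  "hrank H A = rk (bverts H) (bedge ` incidences_at H A)"

lemma bverts_iff [simp]: "Inl v \<in> bverts H \<longleftrightarrow> v \<in> hverts H" "Inr e \<in> bverts H \<longleftrightarrow> e \<in> hedges H"
  by (auto simp: bverts_def)

lemma inj_bedge: "inj bedge"
  by (auto simp: inj_def bedge_def doubleton_eq_iff)

lemma Bip_eq: "Bip H = (bverts H, bedge ` incidences H)"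
  by (simp add: Bip_def bverts_def bedge_def[abs_def] case_prod_beta)

lemma finite_bverts: "is_hypergraph H \<Longrightarrow> finite (bverts H)"
  by (simp add: is_hypergraph_def bverts_def)

lemma finite_incidences: "is_hypergraph H \<Longrightarrow> finite (incidences H)"
  by (rule finite_subset[of _ "hverts H \<times> hedges H"]) (auto simp: is_hypergraph_def incidences_def)

lemma card_bverts: "is_hypergraph H \<Longrightarrow> card (bverts H) = card (hverts H) + card (hedges H)"
  by (simp add: is_hypergraph_def bverts_def card_Plus)

lemma bedge_ends: "i \<in> incidences H \<Longrightarrow> \<exists>a\<in>bverts H. \<exists>b\<in>bverts H. a \<noteq> b \<and> bedge i = {a, b}"
  by (rule bexI[of _ "Inl (fst i)"], rule bexI[of _ "Inr (snd i)"])
     (auto simp: incidences_def bverts_def bedge_def)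

lemma unit_rank_bedge:
  assumes "is_hypergraph H"
  shows "unit_rank (incidences H) (\<lambda>S. rk (bverts H) (bedge ` S))"
  using finite_bverts[OF assms] finite_incidences[OF assms]
  by (rule unit_rank_rk) (use bedge_ends in blast)

lemma hverts_nonempty:
  assumes "is_hypergraph H" "ugraph_connected (Bip H)"
  shows "hverts H \<noteq> {}"
proof -
  have "bverts H \<noteq> {}" using assms(2) by (simp add: ugraph_connected_def Bip_eq)
  then show ?thesis using assms(1) by (auto simp: bverts_def is_hypergraph_def)
qed

lemma rk_connected:
  assumes "finite X" "X \<noteq> {}"
  shows "ugraph_connected (X, S) \<longleftrightarrow> rk X S = card X - 1"
proof -
  have "card X > 0" using assms card_gt_0_iff by blast
  moreover have "ncomp X S > 0"
    unfolding ncomp_def ugraph_components_cls using assms by (simp add: card_gt_0_iff)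
  ultimately show ?thesis
    unfolding ugraph_connected_iff_ncomp[OF assms] rk_def
    using ncomp_le[OF assms(1), of S] by auto
qed

lemma ugraph_degree_bedge:
  "ugraph_degree (X, bedge ` T) (Inr e) = card {i \<in> T. snd i = e}"
proof -
  have "{t \<in> bedge ` T. Inr e \<in> t} = bedge ` {i \<in> T. snd i = e}"
    by (auto simp: bedge_def)
  then show ?thesis
    unfolding ugraph_degree_def
    using card_image[OF inj_on_subset[OF inj_bedge, of "{i \<in> T. snd i = e}"]] by simp
qed

lemma card_incidences_partition:
  assumes "finite T" "finite A"
  shows "card {i \<in> T. snd i \<in> A} = (\<Sum>e\<in>A. card {i \<in> T. snd i = e})"
proof -
  have "{i \<in> T. snd i \<in> A} = (\<Union>e\<in>A. {i \<in> T. snd i = e})" by auto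
  then show ?thesis using assms by (simp only:) (intro card_UN_disjoint, auto)
qed

text \<open>The edges of a spanning tree at \<open>A\<close> are independent, and their number is
  the sum of the degrees \<open>f e + 1\<close>. Conversely, Rado's theorem with the degrees as
  weights gives an independent edge set; the prescribed total makes it a basis, i.e. a spanning
  tree.\<close>

lemma hypertrees_iff_hrank:
  assumes H: "is_hypergraph H" "ugraph_connected (Bip H)"
  shows "f \<in> hypertrees H \<longleftrightarrow> f \<in> hedges H \<rightarrow>\<^sub>E UNIV \<and>
     (\<forall>A\<subseteq>hedges H. (\<Sum>e\<in>A. f e + 1) \<le> hrank H A) \<and>
     (\<Sum>e\<in>hedges H. f e + 1) = card (bverts H) - 1"
proof -
  let ?X = "bverts H" and ?I = "incidences H"
  note X = finite_bverts[OF H(1)] and I = finite_incidences[OF H(1)]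
  have E: "finite (hedges H)" using H by (simp add: is_hypergraph_def)
  have ne: "?X \<noteq> {}" using hverts_nonempty[OF H] by (auto simp: bverts_def)
  have sndI': "snd i \<in> hedges H" if "i \<in> ?I" for i
    using that by (auto simp: incidences_def)
  then have sndI: "snd ` ?I \<subseteq> hedges H" by blast
  interpret unit_rank ?I "\<lambda>S. rk ?X (bedge ` S)"
    by (rule unit_rank_bedge[OF H(1)])
  have card_bedge: "card (bedge ` S) = card S" for S :: "('a \<times> 'b) set"
    by (rule card_image[OF inj_on_subset[OF inj_bedge]]) simp
  show ?thesis
  proof (intro iffI conjI allI impI)
    assume f: "f \<in> hypertrees H"
    then show "f \<in> hedges H \<rightarrow>\<^sub>E UNIV" by (simp add: hypertrees_def)
    obtain T where T: "spanning_tree T (Bip H)"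
       and deg: "\<And>e. e \<in> hedges H \<Longrightarrow> ugraph_degree T (Inr e) = f e + 1"
      using f by (auto simp: hypertrees_def)
    obtain T0 where T0: "T0 \<subseteq> ?I" "snd T = bedge ` T0"
      using T by (auto simp: spanning_tree_def Bip_eq subset_image_iff)
    have TX: "T = (?X, bedge ` T0)"
      using T T0 by (simp add: spanning_tree_def Bip_eq prod_eq_iff)
    have finT: "finite T0" using T0 I finite_subset by blast
    have acyc: "\<nexists>xs. ugraph_cycle (?X, bedge ` T0) xs" and con: "ugraph_connected (?X, bedge ` T0)"
      using T TX by (auto simp: spanning_tree_def ugraph_tree_def)
    have rkS: "rk ?X (bedge ` S) = card S" if "S \<subseteq> T0" for S
    proof -
      have "\<not> ugraph_cycle (?X, bedge ` S) xs" for xs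
      proof
        assume c: "ugraph_cycle (?X, bedge ` S) xs"
        have "ugraph_adj (?X, bedge ` S) \<subseteq> ugraph_adj (?X, bedge ` T0)"
          using that by (auto simp: ugraph_adj_def)
        then have "ugraph_cycle (?X, bedge ` T0) xs"
          using c unfolding ugraph_cycle_def by blast
        then show False using acyc by blast
      qed
      then have "rk ?X (bedge ` S) = card (bedge ` S)"
        using that T0 bedge_ends[of _ H] finite_subset[OF that finT]
        by (intro acyclic_rk X) auto
      then show ?thesis by (simp add: card_bedge)
    qed
    have sum: "(\<Sum>e\<in>A. f e + 1) = card {i \<in> T0. snd i \<in> A}" if "A \<subseteq> hedges H" for A
    proof -
      have "(\<Sum>e\<in>A. f e + 1) = (\<Sum>e\<in>A. card {i \<in> T0. snd i = e})"
        using deg that unfolding TX ugraph_degree_bedge by (intro sum.cong) auto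
      then show ?thesis
        using card_incidences_partition[OF finT finite_subset[OF that E]] by simp
    qed
    show "(\<Sum>e\<in>A. f e + 1) \<le> hrank H A" if A: "A \<subseteq> hedges H" for A
    proof -
      have "card {i \<in> T0. snd i \<in> A} = rk ?X (bedge ` {i \<in> T0. snd i \<in> A})"
        by (rule rkS[symmetric]) auto
      also have "\<dots> \<le> hrank H A"
        unfolding hrank_def by (rule rank_mono) (use T0 in \<open>auto simp: incidences_at_def\<close>)
      finally show ?thesis using sum[OF A] by simp
    qed
    have "{i \<in> T0. snd i \<in> hedges H} = T0" using T0(1) sndI' by blast
    then have "(\<Sum>e\<in>hedges H. f e + 1) = rk ?X (bedge ` T0)"
      using sum[of "hedges H"] rkS[of T0] by simp
    then show "(\<Sum>e\<in>hedges H. f e + 1) = card ?X - 1"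
      using con rk_connected[OF X ne] by simp
  next
    assume f: "f \<in> hedges H \<rightarrow>\<^sub>E UNIV \<and>
     (\<forall>A\<subseteq>hedges H. (\<Sum>e\<in>A. f e + 1) \<le> hrank H A) \<and>
     (\<Sum>e\<in>hedges H. f e + 1) = card (bverts H) - 1"
    have "(\<Sum>e\<in>A. f e + 1) \<le> rk ?X (bedge ` {i \<in> ?I. snd i \<in> A})" if "A \<subseteq> hedges H" for A
      using f that by (simp add: hrank_def incidences_at_def)
    then obtain T where T: "T \<subseteq> ?I" "rk ?X (bedge ` T) = card T"
      "\<And>e. e \<in> hedges H \<Longrightarrow> card {i \<in> T. snd i = e} = f e + 1"
      using Rado[OF E sndI, of "\<lambda>e. f e + 1"] by blast
    have finT: "finite T" using T I finite_subset by blast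
    have "{i \<in> T. snd i \<in> hedges H} = T" using T(1) sndI' by blast
    then have "card T = card ?X - 1"
      using card_incidences_partition[OF finT E] T(3) f by simp
    then have con: "ugraph_connected (?X, bedge ` T)"
      using rk_connected[OF X ne] T(2) by simp
    have "\<not> ugraph_cycle (?X, bedge ` T) xs" for xs
    proof (rule rk_eq_card_acyclic[OF X])
      show "rk ?X (bedge ` T) = card (bedge ` T)" using T by (simp add: card_bedge)
      fix t assume "t \<in> bedge ` T"
      then show "\<exists>a\<in>?X. \<exists>b\<in>?X. t = {a, b}" using T(1) bedge_ends[of _ H] by blast
    qed (use finT in simp)
    then have "spanning_tree (?X, bedge ` T) (Bip H)"
      using con T(1) by (auto simp: spanning_tree_def ugraph_tree_def Bip_eq)
    moreover have "\<forall>e\<in>hedges H. ugraph_degree (?X, bedge ` T) (Inr e) = f e + 1"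
      using T(3) by (simp add: ugraph_degree_bedge)
    ultimately show "f \<in> hypertrees H"
      using f unfolding hypertrees_def by blast
  qed
qed

section \<open>The polytope in terms of the rank function\<close>

text \<open>Nodes outside the restricted hypergraph are isolated and cancel. Moving
  \<open>card A\<close> to the other side turns the rank into the bound that defines the
  polytope.\<close>

lemma hrank_num_comps:
  assumes H: "is_hypergraph H" and A: "A \<subseteq> hedges H"
  shows "hrank H A + num_comps H A = card (\<Union>(hinc H ` A)) + card A"
proof -
  let ?X = "bverts H" and ?X' = "\<Union>(hinc H ` A) <+> A"
  note X = finite_bverts[OF H]
  have sub: "\<Union>(hinc H ` A) \<subseteq> hverts H" using H A by (auto simp: is_hypergraph_def)
  then have X': "?X' \<subseteq> ?X" using A by (auto simp: bverts_def)
  have fin: "finite (\<Union>(hinc H ` A))" "finite A"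
    using sub A H by (auto simp: is_hypergraph_def intro: finite_subset)
  have inc: "incidences (hrestrict H A) = incidences_at H A"
    using sub A by (auto simp: incidences_def hrestrict_def incidences_at_def)
  have nc: "num_comps H A = ncomp ?X' (bedge ` incidences_at H A)"
    by (simp add: num_comps_def ncomp_def Bip_eq inc) (simp add: bverts_def hrestrict_def)
  have "ncomp ?X (bedge ` incidences_at H A) = ncomp ?X' (bedge ` incidences_at H A) + card (?X - ?X')"
    by (rule ncomp_extend[OF X X'])
       (auto simp: bedge_def incidences_at_def incidences_def)
  moreover have "card (?X - ?X') = card ?X - card ?X'"
    using X' finite_subset[OF X' X] by (intro card_Diff_subset)
  moreover have "card ?X' \<le> card ?X" using X' X by (rule card_mono[rotated])
  moreover have "ncomp ?X' (bedge ` incidences_at H A) \<le> card ?X'"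
    using X X' finite_subset by (intro ncomp_le) blast
  moreover have "card ?X' = card (\<Union>(hinc H ` A)) + card A"
    using fin by (simp add: card_Plus)
  ultimately show ?thesis unfolding hrank_def rk_def nc by simp
qed

lemma num_comps_pos:
  assumes H: "is_hypergraph H" and A: "A \<subseteq> hedges H" "A \<noteq> {}"
  shows "num_comps H A > 0"
proof -
  have fin: "finite (bverts (hrestrict H A))"
  proof -
    have "\<Union>(hinc H ` A) \<subseteq> hverts H" using H A by (auto simp: is_hypergraph_def)
    then show ?thesis
      using H A by (auto simp: is_hypergraph_def bverts_def hrestrict_def intro: finite_subset)
  qed
  moreover have "bverts (hrestrict H A) \<noteq> {}"
    using A by (auto simp: bverts_def hrestrict_def)
  ultimately show ?thesis
    unfolding num_comps_def Bip_eq ugraph_components_cls by (simp add: card_gt_0_iff)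
qed

text \<open>The function \<open>g\<close> of the overview, integer valued so that the duality
  identity can be stated with honest subtraction.\<close>

definition hmu :: "('v, 'e) hypergraph \<Rightarrow> 'e set \<Rightarrow> int" where
  "hmu H A = int (hrank H A) - int (card A)"

lemma hmu_empty: "hmu H {} = 0"
  by (simp add: hmu_def hrank_def incidences_at_def rk_def ncomp_empty)

lemma hmu_le:
  assumes H: "is_hypergraph H" "hverts H \<noteq> {}" and A: "A \<subseteq> hedges H"
  shows "hmu H A \<le> int (card (hverts H)) - 1"
proof (cases "A = {}")
  case True
  have "card (hverts H) > 0" using H by (simp add: is_hypergraph_def card_gt_0_iff)
  then show ?thesis using True by (simp add: hmu_empty)
next
  case False
  have "\<Union>(hinc H ` A) \<subseteq> hverts H" "finite (hverts H)" using H A by (auto simp: is_hypergraph_def)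
  then have "card (\<Union>(hinc H ` A)) \<le> card (hverts H)" by (intro card_mono)
  then show ?thesis
    using hrank_num_comps[OF H(1) A] num_comps_pos[OF H(1) A False] unfolding hmu_def by linarith
qed

lemma hypertree_polytope_hmu:
  assumes H: "is_hypergraph H" "hverts H \<noteq> {}"
  shows "x \<in> hypertree_polytope H \<longleftrightarrow> x \<in> hedges H \<rightarrow>\<^sub>E UNIV \<and>
    (\<forall>A\<subseteq>hedges H. (\<Sum>e\<in>A. x e) \<le> real_of_int (hmu H A)) \<and>
    (\<Sum>e\<in>hedges H. x e) = real (card (hverts H)) - 1"
proof -
  have E: "finite (hedges H)" using H by (simp add: is_hypergraph_def)
  have mu: "real (card (\<Union>(hinc H ` A))) - real (num_comps H A) = real_of_int (hmu H A)"
    if "A \<subseteq> hedges H" for A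
    using hrank_num_comps[OF H(1) that] by (simp add: hmu_def)
  have pos: "0 \<le> x e" if x: "\<forall>A\<subseteq>hedges H. (\<Sum>e\<in>A. x e) \<le> real_of_int (hmu H A)"
    "(\<Sum>e\<in>hedges H. x e) = real (card (hverts H)) - 1" and e: "e \<in> hedges H" for e
  proof -
    have "(\<Sum>e\<in>hedges H. x e) = x e + (\<Sum>e\<in>hedges H - {e}. x e)"
      using E e by (rule sum.remove)
    moreover have "(\<Sum>e\<in>hedges H - {e}. x e) \<le> real_of_int (hmu H (hedges H - {e}))"
      using x(1) by blast
    moreover have "real_of_int (hmu H (hedges H - {e})) \<le> real (card (hverts H)) - 1"
      using hmu_le[OF H Diff_subset, of "{e}"] by linarith
    ultimately show ?thesis using x(2) by linarith
  qed
  show ?thesis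
  proof
    assume x: "x \<in> hypertree_polytope H"
    have "(\<Sum>e\<in>A. x e) \<le> real_of_int (hmu H A)" if A: "A \<subseteq> hedges H" for A
    proof (cases "A = {}")
      case False
      then have "(\<Sum>e\<in>A. x e) \<le> real (card (\<Union>(hinc H ` A))) - real (num_comps H A)"
        using x A by (simp add: hypertree_polytope_def)
      then show ?thesis using mu[OF A] by simp
    qed (simp add: hmu_empty)
    then show "x \<in> hedges H \<rightarrow>\<^sub>E UNIV \<and>
      (\<forall>A\<subseteq>hedges H. (\<Sum>e\<in>A. x e) \<le> real_of_int (hmu H A)) \<and>
      (\<Sum>e\<in>hedges H. x e) = real (card (hverts H)) - 1"
      using x by (simp add: hypertree_polytope_def)
  next
    assume x: "x \<in> hedges H \<rightarrow>\<^sub>E UNIV \<and>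
      (\<forall>A\<subseteq>hedges H. (\<Sum>e\<in>A. x e) \<le> real_of_int (hmu H A)) \<and>
      (\<Sum>e\<in>hedges H. x e) = real (card (hverts H)) - 1"
    then have "\<forall>e\<in>hedges H. 0 \<le> x e" using pos by blast
    moreover have "\<forall>A. A \<noteq> {} \<and> A \<subseteq> hedges H \<longrightarrow>
      (\<Sum>e\<in>A. x e) \<le> real (card (\<Union>(hinc H ` A))) - real (num_comps H A)"
      using x mu by auto
    ultimately show "x \<in> hypertree_polytope H"
      using x unfolding hypertree_polytope_def by blast
  qed
qed

lemma hypertrees_iff_polytope:
  assumes H: "is_hypergraph H" "ugraph_connected (Bip H)"
  shows "f \<in> hypertrees H \<longleftrightarrow> f \<in> hedges H \<rightarrow>\<^sub>E UNIV \<and>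
     (\<lambda>e\<in>hedges H. real (f e)) \<in> hypertree_polytope H"
proof -
  note ne = hverts_nonempty[OF H]
  have E: "finite (hedges H)" using H by (simp add: is_hypergraph_def)
  have "card (hverts H) > 0" using ne H(1) by (simp add: is_hypergraph_def card_gt_0_iff)
  then have tot: "(\<Sum>e\<in>hedges H. f e + 1) = card (bverts H) - 1 \<longleftrightarrow>
      (\<Sum>e\<in>hedges H. real (f e)) = real (card (hverts H)) - 1"
  proof -
    assume pos: "card (hverts H) > 0"
    have "(\<Sum>e\<in>hedges H. f e + 1) = (\<Sum>e\<in>hedges H. f e) + card (hedges H)"
      by (simp add: sum_Suc)
    moreover have "(\<Sum>e\<in>hedges H. real (f e)) = real (\<Sum>e\<in>hedges H. f e)" by simp
    ultimately show ?thesis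
      unfolding card_bverts[OF H(1)] using pos by linarith
  qed
  have le: "(\<Sum>e\<in>A. f e + 1) \<le> hrank H A \<longleftrightarrow>
      (\<Sum>e\<in>A. (\<lambda>e\<in>hedges H. real (f e)) e) \<le> real_of_int (hmu H A)"
    if "A \<subseteq> hedges H" for A
  proof -
    have "(\<Sum>e\<in>A. (\<lambda>e\<in>hedges H. real (f e)) e) = (\<Sum>e\<in>A. real (f e))"
      using that by (intro sum.cong) auto
    also have "\<dots> = real (\<Sum>e\<in>A. f e)" by simp
    finally have "(\<Sum>e\<in>A. (\<lambda>e\<in>hedges H. real (f e)) e) = real (\<Sum>e\<in>A. f e)" .
    moreover have "(\<Sum>e\<in>A. f e + 1) = (\<Sum>e\<in>A. f e) + card A" by (simp add: sum_Suc)
    ultimately show ?thesis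
      unfolding hmu_def by linarith
  qed
  show ?thesis
    unfolding hypertrees_iff_hrank[OF H] hypertree_polytope_hmu[OF H(1) ne] tot
    using le by auto
qed

section \<open>Hypergraphs with complementary rank functions\<close>

text \<open>For connected \<open>H\<close> the number \<open>card (hverts H) - 1\<close> is the
  value of \<open>hmu H\<close> on all hyperedges, so \<open>hmu_dual\<close> is matroid duality
  with the weights \<open>d\<close> in place of cardinalities.\<close>

locale dual_hypergraphs =
  fixes H :: "('v, 'e) hypergraph" and H' :: "('w, 'e) hypergraph" and d :: "'e \<Rightarrow> nat"
  assumes H: "is_hypergraph H" "ugraph_connected (Bip H)"
    and H': "is_hypergraph H'" "ugraph_connected (Bip H')"
    and hedges_eq: "hedges H' = hedges H"
    and hmu_dual: "A \<subseteq> hedges H \<Longrightarrow>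
      hmu H' (hedges H - A) = (\<Sum>e\<in>hedges H - A. int (d e)) + hmu H A - (int (card (hverts H)) - 1)"
    and hverts_dual: "int (card (hverts H')) - 1 =
      (\<Sum>e\<in>hedges H. int (d e)) - (int (card (hverts H)) - 1)"
begin

abbreviation "E \<equiv> hedges H"

lemma finite_E: "finite E"
  using H by (simp add: is_hypergraph_def)

text \<open>Once the total is fixed, the constraint of \<open>x\<close> at \<open>A\<close> is the
  constraint of the reflected point at \<open>E - A\<close>. Being an equivalence, this serves both
  directions.\<close>

lemma polytope_reflect:
  assumes x: "x \<in> E \<rightarrow>\<^sub>E UNIV"
  shows "(\<lambda>e\<in>E. real (d e) - x e) \<in> hypertree_polytope H' \<longleftrightarrow> x \<in> hypertree_polytope H"
proof -
  let ?y = "\<lambda>e\<in>E. real (d e) - x e"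
  have sum_y: "(\<Sum>e\<in>A. ?y e) = (\<Sum>e\<in>A. real (d e)) - (\<Sum>e\<in>A. x e)" if "A \<subseteq> E" for A
  proof -
    have "(\<Sum>e\<in>A. ?y e) = (\<Sum>e\<in>A. real (d e) - x e)"
      using that by (intro sum.cong) auto
    then show ?thesis by (simp add: sum_subtractf)
  qed
  have vd: "real (card (hverts H')) - 1 = (\<Sum>e\<in>E. real (d e)) - (real (card (hverts H)) - 1)"
  proof -
    have "real_of_int (int (card (hverts H')) - 1) =
      real_of_int ((\<Sum>e\<in>hedges H. int (d e)) - (int (card (hverts H)) - 1))"
      using hverts_dual by (simp only:)
    then show ?thesis by simp
  qed
  have tot: "(\<Sum>e\<in>E. ?y e) = real (card (hverts H')) - 1 \<longleftrightarrow>
      (\<Sum>e\<in>E. x e) = real (card (hverts H)) - 1"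
    unfolding sum_y[OF order_refl] vd by linarith
  have le: "(\<Sum>e\<in>E - A. ?y e) \<le> real_of_int (hmu H' (E - A)) \<longleftrightarrow>
      (\<Sum>e\<in>A. x e) \<le> real_of_int (hmu H A)"
    if A: "A \<subseteq> E" and t: "(\<Sum>e\<in>E. x e) = real (card (hverts H)) - 1" for A
  proof -
    have "(\<Sum>e\<in>E. x e) = (\<Sum>e\<in>E - A. x e) + (\<Sum>e\<in>A. x e)"
      using A finite_E by (rule sum.subset_diff)
    moreover have "real_of_int (hmu H' (E - A)) =
        (\<Sum>e\<in>E - A. real (d e)) + real_of_int (hmu H A) - (real (card (hverts H)) - 1)"
      unfolding hmu_dual[OF A] by simp
    ultimately show ?thesis
      using t sum_y[of "E - A"] by auto
  qed
  have "(\<forall>B\<subseteq>E. (\<Sum>e\<in>B. ?y e) \<le> real_of_int (hmu H' B)) \<longleftrightarrow>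
      (\<forall>A\<subseteq>E. (\<Sum>e\<in>A. x e) \<le> real_of_int (hmu H A))"
    if t: "(\<Sum>e\<in>E. x e) = real (card (hverts H)) - 1"
  proof (intro iffI allI impI)
    fix A assume *: "\<forall>B\<subseteq>E. (\<Sum>e\<in>B. ?y e) \<le> real_of_int (hmu H' B)" and A: "A \<subseteq> E"
    have "(\<Sum>e\<in>E - A. ?y e) \<le> real_of_int (hmu H' (E - A))" using * Diff_subset by metis
    then show "(\<Sum>e\<in>A. x e) \<le> real_of_int (hmu H A)" using le[OF A t] by simp
  next
    fix B assume *: "\<forall>A\<subseteq>E. (\<Sum>e\<in>A. x e) \<le> real_of_int (hmu H A)" and B: "B \<subseteq> E"
    have "(\<Sum>e\<in>E - B. x e) \<le> real_of_int (hmu H (E - B))" using * Diff_subset by metis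
    then have "(\<Sum>e\<in>E - (E - B). ?y e) \<le> real_of_int (hmu H' (E - (E - B)))"
      using le[of "E - B"] t by blast
    then show "(\<Sum>e\<in>B. ?y e) \<le> real_of_int (hmu H' B)" using B by (simp add: double_diff)
  qed
  then show ?thesis
    unfolding hypertree_polytope_hmu[OF H(1) hverts_nonempty[OF H]]
      hypertree_polytope_hmu[OF H'(1) hverts_nonempty[OF H']] hedges_eq tot
    using x by auto
qed

lemma polytope_subset: "hypertree_polytope H \<subseteq> E \<rightarrow>\<^sub>E UNIV"
  "hypertree_polytope H' \<subseteq> E \<rightarrow>\<^sub>E UNIV"
  by (auto simp: hypertree_polytope_def hedges_eq)

lemma reflect_reflect:
  fixes x :: "'e \<Rightarrow> real"
  assumes "x \<in> E \<rightarrow>\<^sub>E UNIV"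
  shows "(\<lambda>e\<in>E. real (d e) - (\<lambda>e\<in>E. real (d e) - x e) e) = x"
  using assms by (auto simp: fun_eq_iff restrict_def PiE_def extensional_def)

lemma polytope_image:
  "hypertree_polytope H' = (\<lambda>x. \<lambda>e\<in>E. real (d e) - x e) ` hypertree_polytope H"
proof (intro equalityI subsetI)
  fix y assume y: "y \<in> hypertree_polytope H'"
  then have yE: "y \<in> E \<rightarrow>\<^sub>E UNIV" using polytope_subset by blast
  let ?x = "\<lambda>e\<in>E. real (d e) - y e"
  have x: "?x \<in> hypertree_polytope H"
    using polytope_reflect[of ?x] y unfolding reflect_reflect[OF yE] by simp
  show "y \<in> (\<lambda>x. \<lambda>e\<in>E. real (d e) - x e) ` hypertree_polytope H"
    by (rule image_eqI[OF _ x]) (rule reflect_reflect[OF yE, symmetric])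
next
  fix y assume "y \<in> (\<lambda>x. \<lambda>e\<in>E. real (d e) - x e) ` hypertree_polytope H"
  then obtain x where x: "x \<in> hypertree_polytope H" "y = (\<lambda>e\<in>E. real (d e) - x e)" by blast
  then show "y \<in> hypertree_polytope H'"
    using polytope_reflect[of x] polytope_subset by blast
qed

section \<open>Reflection of hypertrees and transfers of valence\<close>

definition reflect :: "('e \<Rightarrow> nat) \<Rightarrow> 'e \<Rightarrow> nat" where
  "reflect f = (\<lambda>e\<in>E. d e - f e)"

text \<open>Points of the dual polytope are nonnegative; for the reflected point this says
  \<open>f e \<le> d e\<close>, which makes the subtraction of natural numbers in
  \<open>reflect\<close> exact.\<close>

lemma reflect_hypertree:
  assumes "f \<in> hypertrees H"
  shows "e \<in> E \<Longrightarrow> f e \<le> d e"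
    and "reflect f \<in> hypertrees H'"
proof -
  have f: "f \<in> E \<rightarrow>\<^sub>E UNIV" "(\<lambda>e\<in>E. real (f e)) \<in> hypertree_polytope H"
    using assms hypertrees_iff_polytope[OF H] by auto
  then have y: "(\<lambda>e\<in>E. real (d e) - (\<lambda>e\<in>E. real (f e)) e) \<in> hypertree_polytope H'"
    using polytope_reflect[of "\<lambda>e\<in>E. real (f e)"] by simp
  have le: "f e \<le> d e" if e: "e \<in> E" for e
  proof -
    have "0 \<le> (\<lambda>e\<in>E. real (d e) - (\<lambda>e\<in>E. real (f e)) e) e"
      using y e unfolding hypertree_polytope_def hedges_eq by blast
    then show ?thesis using e by simp
  qed
  then show "e \<in> E \<Longrightarrow> f e \<le> d e" .
  have "(\<lambda>e\<in>E. real (reflect f e)) = (\<lambda>e\<in>E. real (d e) - (\<lambda>e\<in>E. real (f e)) e)"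
    using le by (auto simp: reflect_def restrict_def fun_eq_iff)
  then show "reflect f \<in> hypertrees H'"
    unfolding hypertrees_iff_polytope[OF H'] hedges_eq using y by (simp add: reflect_def)
qed

lemma reflect_involution:
  assumes "f \<in> E \<rightarrow>\<^sub>E UNIV" "\<And>e. e \<in> E \<Longrightarrow> f e \<le> d e"
  shows "reflect (reflect f) = f"
  using assms by (auto simp: reflect_def fun_eq_iff restrict_def PiE_def extensional_def)

text \<open>The locale is not symmetric in its two hypergraphs, so \<open>polytope_reflect\<close>
  is used backwards, on the reflection of the given point.\<close>

lemma reflect_dual_hypertree:
  assumes "g \<in> hypertrees H'"
  shows "e \<in> E \<Longrightarrow> g e \<le> d e"
    and "reflect g \<in> hypertrees H"
proof -
  have g: "g \<in> E \<rightarrow>\<^sub>E UNIV" "(\<lambda>e\<in>E. real (g e)) \<in> hypertree_polytope H'"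
    using assms hypertrees_iff_polytope[OF H'] by (auto simp: hedges_eq)
  let ?x = "\<lambda>e\<in>E. real (d e) - (\<lambda>e\<in>E. real (g e)) e"
  have y: "?x \<in> hypertree_polytope H"
    using polytope_reflect[of ?x] reflect_reflect[of "\<lambda>e\<in>E. real (g e)"] g by simp
  have le: "g e \<le> d e" if e: "e \<in> E" for e
  proof -
    have "0 \<le> ?x e"
      using y e unfolding hypertree_polytope_def by blast
    then show ?thesis using e by simp
  qed
  then show "e \<in> E \<Longrightarrow> g e \<le> d e" .
  have "(\<lambda>e\<in>E. real (reflect g e)) = ?x"
    using le by (auto simp: reflect_def restrict_def fun_eq_iff)
  then show "reflect g \<in> hypertrees H"
    unfolding hypertrees_iff_polytope[OF H] using y by (simp add: reflect_def)
qed

lemma hypertrees_PiE: "f \<in> hypertrees H \<Longrightarrow> f \<in> E \<rightarrow>\<^sub>E UNIV" "g \<in> hypertrees H' \<Longrightarrow> g \<in> E \<rightarrow>\<^sub>E UNIV"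
  by (auto simp: hypertrees_def hedges_eq)

lemma bij_reflect: "bij_betw reflect (hypertrees H) (hypertrees H')"
proof (rule bij_betw_byWitness[where f' = reflect])
  show "\<forall>f\<in>hypertrees H. reflect (reflect f) = f"
    using reflect_involution reflect_hypertree(1) hypertrees_PiE(1) by blast
  show "\<forall>f\<in>hypertrees H'. reflect (reflect f) = f"
    using reflect_involution reflect_dual_hypertree(1) hypertrees_PiE(2) by blast
qed (use reflect_hypertree(2) reflect_dual_hypertree(2) in auto)

lemma transfer_reflect:
  assumes f: "f \<in> hypertrees H"
  shows "transfer_possible H' (reflect f) a b \<longleftrightarrow> transfer_possible H f b a"
proof (cases "a \<in> E \<and> b \<in> E \<and> a \<noteq> b")
  case True
  have fE: "f \<in> E \<rightarrow>\<^sub>E UNIV" using hypertrees_PiE f by blast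
  let ?g = "(reflect f)(a := reflect f a - 1, b := reflect f b + 1)"
  let ?h = "f(b := f b - 1, a := f a + 1)"
  have gE: "?g \<in> E \<rightarrow>\<^sub>E UNIV" "?h \<in> E \<rightarrow>\<^sub>E UNIV"
    using True fE by (auto simp: reflect_def PiE_def extensional_def)
  have fle: "f a \<le> d a" "f b \<le> d b" using reflect_hypertree(1)[OF f] True by auto
  show ?thesis
  proof
    assume t: "transfer_possible H' (reflect f) a b"
    then have g: "?g \<in> hypertrees H'" "0 < reflect f a" by (auto simp: transfer_possible_def)
    \<comment> \<open>The guard against truncation comes from the bound on the new hypertree:
      raising the reflected value at \<open>b\<close> is possible only if \<open>f b\<close> is
      positive. The other direction argues in the same way at \<open>a\<close>.\<close>
    have "?g b \<le> d b" using reflect_dual_hypertree(1)[OF g(1)] True by blast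
    then have pos: "0 < f b" using True by (auto simp: reflect_def)
    have "reflect ?g = ?h"
      using True fE g(2) pos reflect_hypertree(1)[OF f] fle
      by (auto simp: reflect_def fun_eq_iff restrict_def PiE_def extensional_def)
    then show "transfer_possible H f b a"
      using reflect_dual_hypertree(2)[OF g(1)] True pos by (auto simp: transfer_possible_def)
  next
    assume t: "transfer_possible H f b a"
    then have h: "?h \<in> hypertrees H" "0 < f b" by (auto simp: transfer_possible_def)
    have "?h a \<le> d a" using reflect_hypertree(1)[OF h(1)] True by blast
    then have pos: "0 < reflect f a" using True by (auto simp: reflect_def)
    have "reflect ?h = ?g"
      using True fE h(2) pos reflect_hypertree(1)[OF f] fle
      by (auto simp: reflect_def fun_eq_iff restrict_def PiE_def extensional_def Suc_diff_le)
    then show "transfer_possible H' (reflect f) a b"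
      using reflect_hypertree(2)[OF h(1)] True pos by (auto simp: transfer_possible_def hedges_eq)
  qed
qed (auto simp: transfer_possible_def hedges_eq)

text \<open>Reflection reverses transfers but keeps the order, so a transfer from \<open>e\<close>
  to a smaller hyperedge becomes a transfer to \<open>e\<close> from that smaller hyperedge.\<close>

lemma inactivity_reflect:
  assumes f: "f \<in> hypertrees H"
  shows "internal_inactivity r H' (reflect f) = external_inactivity r H f"
    "external_inactivity r H' (reflect f) = internal_inactivity r H f"
  by (simp_all add: internal_inactivity_def external_inactivity_def transfer_reflect[OF f] hedges_eq)

lemma polynomials_dual:
  "interior_polynomial r H' = exterior_polynomial r H"
  "exterior_polynomial r H' = interior_polynomial r H"
proof -
  have s: "(\<Sum>g\<in>hypertrees H'. F g) = (\<Sum>f\<in>hypertrees H. F (reflect f))" for F :: "_ \<Rightarrow> int poly"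
    by (rule sum.reindex_bij_betw[OF bij_reflect, symmetric])
  show "interior_polynomial r H' = exterior_polynomial r H"
    unfolding interior_polynomial_def exterior_polynomial_def s
    by (simp add: inactivity_reflect cong: sum.cong)
  show "exterior_polynomial r H' = interior_polynomial r H"
    unfolding interior_polynomial_def exterior_polynomial_def s
    by (simp add: inactivity_reflect cong: sum.cong)
qed

theorem hypertree_duality:
  "(\<exists>c \<in> E \<rightarrow>\<^sub>E (UNIV :: real set).
      hypertree_polytope H' = (\<lambda>x. \<lambda>e\<in>E. 2 * c e - x e) ` hypertree_polytope H) \<and>
   (\<forall>r. linear_order_on E r \<longrightarrow>
      interior_polynomial r H' = exterior_polynomial r H \<and>
      exterior_polynomial r H' = interior_polynomial r H)"
proof (intro conjI bexI)
  \<comment> \<open>The reflection sends \<open>x\<close> to \<open>d - x\<close>, so its centre is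
    half of \<open>d\<close>.\<close>
  let ?c = "\<lambda>e\<in>E. real (d e) / 2"
  have "(\<lambda>x. \<lambda>e\<in>E. 2 * ?c e - x e) = (\<lambda>x. \<lambda>e\<in>E. real (d e) - x e)"
    by (auto simp: fun_eq_iff restrict_def)
  then show "hypertree_polytope H' = (\<lambda>x. \<lambda>e\<in>E. 2 * ?c e - x e) ` hypertree_polytope H"
    by (simp only: polytope_image)
qed (auto simp: polynomials_dual)

end

section \<open>Euler's formula for plane hypergraphs\<close>

lemma connected_S2_diff_finite:
  assumes "finite F"
  shows "connected (S2 - F)"
  using assms
proof (induction F)
  case empty
  show ?case using connected_S2 by simp
next
  case (insert p F)
  have "openin (top_of_set S2) (S2 - F)"
    using insert by (intro openin_S2_diff finite_imp_closed) auto
  then have "connected (S2 - F - {p})"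
    using insert by (intro connected_S2_delete) auto
  moreover have "S2 - F - {p} = S2 - insert p F" by auto
  ultimately show ?case by simp
qed

locale plane_drawing =
  fixes H :: "('v, 'e) hypergraph" and D :: "('v, 'e, 'k) drawing"
  assumes plane: "plane_hypergraph H D"
begin

abbreviation "P \<equiv> drawn_points H D"
abbreviation "K \<equiv> dedges D"
abbreviation "pt \<equiv> dpoint D"
abbreviation "im k \<equiv> path_image (dcurve D k)"
abbreviation "vend k \<equiv> Inl (fst (dends D k)) :: 'v + 'e"
abbreviation "eend k \<equiv> Inr (snd (dends D k)) :: 'v + 'e"
abbreviation "kend k \<equiv> bedge (dends D k)"

text \<open>All points are kept and only arcs are dropped, in accordance with ranks over all of
  \<open>bverts H\<close>.\<close>

definition partial_graph :: "'k set \<Rightarrow> (real^3) set" where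
  "partial_graph J = P \<union> (\<Union>k\<in>J. im k)"

definition faces :: "'k set \<Rightarrow> (real^3) set set" where
  "faces J = components (S2 - partial_graph J)"

lemma H: "is_hypergraph H" "ugraph_connected (Bip H)"
  and finite_K: "finite K" and dends_K: "dends D ` K = incidences H"
  and inj_pt: "inj_on pt (bverts H)" and P_S2: "P \<subseteq> S2"
  using plane by (auto simp: plane_hypergraph_def bverts_def)

lemma P_eq: "P = pt ` bverts H"
  by (simp add: drawn_points_def bverts_def)

lemma finite_P: "finite P"
  using finite_bverts[OF H(1)] by (simp add: P_eq)

lemma arc_im: "k \<in> K \<Longrightarrow> arc (dcurve D k)"
  and im_S2: "k \<in> K \<Longrightarrow> im k \<subseteq> S2"
  and start: "k \<in> K \<Longrightarrow> pathstart (dcurve D k) = pt (vend k)"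
  and finish: "k \<in> K \<Longrightarrow> pathfinish (dcurve D k) = pt (eend k)"
  and im_P: "k \<in> K \<Longrightarrow> im k \<inter> P = {pt (vend k), pt (eend k)}"
  and im_im: "k \<in> K \<Longrightarrow> l \<in> K \<Longrightarrow> k \<noteq> l \<Longrightarrow> im k \<inter> im l \<subseteq> P"
  using plane by (auto simp: plane_hypergraph_def)

lemma dends_incidences: "k \<in> K \<Longrightarrow> dends D k \<in> incidences H"
  using dends_K by blast

lemma kend_bverts: "k \<in> K \<Longrightarrow> vend k \<in> bverts H" "k \<in> K \<Longrightarrow> eend k \<in> bverts H"
  using dends_incidences[of k] by (auto simp: bverts_def incidences_def)

lemma pt_P: "x \<in> bverts H \<Longrightarrow> pt x \<in> P"
  by (simp add: P_eq)

lemma ends_im: "k \<in> K \<Longrightarrow> pt (vend k) \<in> im k" "k \<in> K \<Longrightarrow> pt (eend k) \<in> im k"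
  using im_P by auto

lemma compact_points_arcs:
  assumes "finite A" "J \<subseteq> K"
  shows "compact (A \<union> (\<Union>k\<in>J. im k))"
proof -
  have "compact (\<Union>k\<in>J. im k)"
    using assms(2) finite_subset[OF assms(2) finite_K] arc_im
    by (intro compact_UN) (auto intro: compact_arc_image)
  then show ?thesis using assms(1) finite_imp_compact by blast
qed

lemma compact_partial_graph: "J \<subseteq> K \<Longrightarrow> compact (partial_graph J)"
  unfolding partial_graph_def using finite_P by (rule compact_points_arcs)

lemma partial_graph_S2: "J \<subseteq> K \<Longrightarrow> partial_graph J \<subseteq> S2"
  unfolding partial_graph_def using P_S2 im_S2 by blast

lemma closed_partial_graph: "J \<subseteq> K \<Longrightarrow> closed (partial_graph J)"
  by (rule compact_imp_closed[OF compact_partial_graph])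

lemma im_partial_graph:
  assumes "k \<in> K" "J \<subseteq> K" "k \<notin> J"
  shows "im k \<inter> partial_graph J = {pathstart (dcurve D k), pathfinish (dcurve D k)}"
proof -
  have "im k \<inter> partial_graph J = im k \<inter> P"
    unfolding partial_graph_def using im_im[OF assms(1)] assms(2,3) by blast
  then show ?thesis using im_P start finish assms(1) by simp
qed

lemma reach_path_component:
  assumes "(x, y) \<in> reach (kend ` J)" "x \<in> bverts H" "J \<subseteq> K"
  shows "path_component (partial_graph J) (pt x) (pt y)"
  using assms(1)
proof (induction rule: reach_induct)
  case base
  show ?case using pt_P[OF assms(2)] by (simp add: path_component_refl_eq partial_graph_def)
next
  case (step y z)
  then obtain k where k: "k \<in> J" "{y, z} = {vend k, eend k}"
    by (auto simp: bedge_def)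
  have sub: "im k \<subseteq> partial_graph J" using k(1) by (auto simp: partial_graph_def)
  have "path_connected (im k)"
    using k(1) assms(3) arc_im by (blast intro: path_connected_path_image arc_imp_path)
  moreover have "pt y \<in> im k" "pt z \<in> im k"
    using k ends_im assms(3) by (auto simp: doubleton_eq_iff)
  ultimately have "path_component (im k) (pt y) (pt z)"
    by (simp add: path_connected_component)
  then have "path_component (partial_graph J) (pt y) (pt z)"
    using sub path_component_of_subset by blast
  with step.IH show ?case by (rule path_component_trans)
qed

text \<open>Distinct arcs meet only in drawn points, so the part of the drawing connected to
  \<open>a\<close> and the rest are disjoint compact sets. This is the situation in which a new edge
  joins two components.\<close>

lemma partial_graph_split:
  assumes J: "J \<subseteq> K" and a: "a \<in> bverts H"
  obtains G1 G2 where "compact G1" "compact G2" "G1 \<union> G2 = partial_graph J" "G1 \<inter> G2 = {}"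
    "\<And>x. x \<in> bverts H \<Longrightarrow> pt x \<in> G1 \<longleftrightarrow> (a, x) \<in> reach (kend ` J)"
proof -
  define C where "C = {x \<in> bverts H. (a, x) \<in> reach (kend ` J)}"
  define J1 where "J1 = {k \<in> J. vend k \<in> C}"
  define G1 where "G1 = pt ` C \<union> (\<Union>k\<in>J1. im k)"
  define G2 where "G2 = pt ` (bverts H - C) \<union> (\<Union>k\<in>J - J1. im k)"
  have JK: "k \<in> K" if "k \<in> J" for k using that J by auto
  have CX: "C \<subseteq> bverts H" by (auto simp: C_def)
  have eend: "eend k \<in> C \<longleftrightarrow> vend k \<in> C" if "k \<in> J" for k
  proof -
    have 1: "(vend k, eend k) \<in> reach (kend ` J)"
      using that by (intro reach_edge) (auto simp: bedge_def)
    then show ?thesis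
      using reach_trans[OF _ 1, of a] reach_trans[OF _ reach_sym[OF 1], of a] kend_bverts JK[OF that]
      by (auto simp: C_def)
  qed
  have disj: "pt ` C \<inter> pt ` (bverts H - C) = {}"
    using inj_on_image_Int[OF inj_pt CX, of "bverts H - C"] by auto
  have im1: "im k \<inter> P \<subseteq> pt ` C" if "k \<in> J1" for k
    using that im_P eend JK by (auto simp: J1_def)
  have im2: "im k \<inter> P \<subseteq> pt ` (bverts H - C)" if "k \<in> J - J1" for k
    using that im_P[of k] eend[of k] JK[of k] kend_bverts[of k] by (auto simp: J1_def)
  have PC: "pt ` C \<subseteq> P" "pt ` (bverts H - C) \<subseteq> P" using CX by (auto simp: P_eq)
  have finC: "finite C" "finite (bverts H - C)"
    using CX finite_bverts[OF H(1)] finite_subset by auto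
  show ?thesis
  proof
    show "compact G1" "compact G2"
      unfolding G1_def G2_def using finC J
      by (intro compact_points_arcs; auto simp: J1_def)+
    have "P = pt ` C \<union> pt ` (bverts H - C)" using CX by (auto simp: P_eq)
    then show "G1 \<union> G2 = partial_graph J"
      unfolding G1_def G2_def partial_graph_def by (auto simp: J1_def)
    show "G1 \<inter> G2 = {}"
    proof (rule ccontr)
      assume "G1 \<inter> G2 \<noteq> {}"
      then obtain z where z: "z \<in> G1" "z \<in> G2" by auto
      have "z \<in> P"
      proof (rule ccontr)
        assume n: "z \<notin> P"
        then obtain k l where kl: "k \<in> J1" "z \<in> im k" "l \<in> J - J1" "z \<in> im l"
          using z PC by (auto simp: G1_def G2_def)
        then have "z \<in> P"
          using im_im[of k l] JK[of k] JK[of l] by (auto simp: J1_def)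
        then show False using n by simp
      qed
      then have "z \<in> pt ` C" "z \<in> pt ` (bverts H - C)"
        using z im1 im2 unfolding G1_def G2_def by blast+
      then show False using disj by blast
    qed
    fix x assume x: "x \<in> bverts H"
    show "pt x \<in> G1 \<longleftrightarrow> (a, x) \<in> reach (kend ` J)"
    proof
      assume "pt x \<in> G1"
      then have "pt x \<in> pt ` C" using im1 pt_P[OF x] by (auto simp: G1_def)
      then have "x \<in> C" using inj_pt x CX by (auto simp: inj_on_def)
      then show "(a, x) \<in> reach (kend ` J)" by (simp add: C_def)
    qed (use x in \<open>auto simp: G1_def C_def\<close>)
  qed
qed

text \<open>Each added edge either closes a cycle, which splits a face and leaves the rank
  unchanged, or joins two components, which raises the rank and leaves the number of faces
  unchanged. A parallel edge falls under the first case.\<close>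

theorem Euler:
  assumes "J \<subseteq> K"
  shows "finite (faces J)" "card (faces J) + rk (bverts H) (kend ` J) = 1 + card J"
proof -
  have "finite J" using assms finite_K finite_subset by blast
  then have "finite (faces J) \<and> card (faces J) + rk (bverts H) (kend ` J) = 1 + card J"
    using assms
  proof (induction J)
    case empty
    have "connected (S2 - P)"
      using finite_P by (rule connected_S2_diff_finite)
    moreover have "S2 - P \<noteq> {}"
    proof (rule S2_open_diff_finite[OF openin_subtopology_self _ finite_P])
      show "S2 \<noteq> {}" by simp
    qed
    ultimately have "faces {} = {S2 - P}"
      by (simp add: faces_def partial_graph_def components_eq_sing_iff)
    then show ?case by (simp add: rk_def ncomp_empty)
  next
    case (insert k J)
    have k: "k \<in> K" and J: "J \<subseteq> K" using insert.prems by auto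
    have IH: "finite (components (S2 - partial_graph J))"
      "card (components (S2 - partial_graph J)) + rk (bverts H) (kend ` J) = 1 + card J"
      using insert.IH[OF J] by (auto simp: faces_def)
    note vX = kend_bverts(1)[OF k] and eX = kend_bverts(2)[OF k]
    have kend: "kend k = {vend k, eend k}" by (simp add: bedge_def)
    have G: "partial_graph (insert k J) = partial_graph J \<union> im k"
      by (auto simp: partial_graph_def)
    note int = im_partial_graph[OF k J insert.hyps(2)]
    note rkk = rk_insert[OF finite_bverts[OF H(1)] vX eX, of "kend ` J"]
    show ?case
    proof (cases "(vend k, eend k) \<in> reach (kend ` J)")
      case True
      have ne: "pt (vend k) \<noteq> pt (eend k)"
        using inj_on_eq_iff[OF inj_pt vX eX] by simp
      have "path_component (partial_graph J) (pt (vend k)) (pt (eend k))"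
        by (rule reach_path_component[OF True vX J])
      then obtain c where c: "path c" "path_image c \<subseteq> partial_graph J"
        "pathstart c = pt (vend k)" "pathfinish c = pt (eend k)"
        unfolding path_component_def by blast
      \<comment> \<open>The walk in the graph yields only a path; the arc inside it is what the
        Jordan curve argument needs.\<close>
      obtain b where b: "arc b" "path_image b \<subseteq> path_image c"
        "pathstart b = pt (vend k)" "pathfinish b = pt (eend k)"
        by (rule path_contains_arc[OF c(1,3,4) ne])
      have bc: "path_image b \<subseteq> partial_graph J" using b(2) c(2) by (rule subset_trans)
      have "finite (components (S2 - (partial_graph J \<union> im k)))"
        "card (components (S2 - (partial_graph J \<union> im k)))
          = card (components (S2 - partial_graph J)) + 1"
        using components_add_arc_split[OF compact_partial_graph[OF J] partial_graph_S2[OF J]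
            arc_im[OF k] im_S2[OF k] int b(1) bc _ _ IH(1)] b(3,4) start[OF k] finish[OF k] by auto
      then show ?thesis
        using IH(2) rkk True insert.hyps unfolding faces_def G image_insert kend by simp
    next
      case False
      obtain G1 G2 where G12: "compact G1" "compact G2" "G1 \<union> G2 = partial_graph J" "G1 \<inter> G2 = {}"
        and pt: "\<And>x. x \<in> bverts H \<Longrightarrow> pt x \<in> G1 \<longleftrightarrow> (vend k, x) \<in> reach (kend ` J)"
        using partial_graph_split[OF J vX] by blast
      have e1: "pt (vend k) \<in> G1" "pt (eend k) \<notin> G1"
        using pt[OF vX] pt[OF eX] False by auto
      have e2: "pt (eend k) \<in> G2" "pt (vend k) \<notin> G2"
        using pt_P[OF eX] e1 G12(3,4) by (auto simp: partial_graph_def)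
      have int': "im k \<inter> (G1 \<union> G2) = {pt (vend k), pt (eend k)}"
        using int G12(3) start[OF k] finish[OF k] by simp
      have i1: "im k \<inter> G1 = {pathstart (dcurve D k)}"
      proof -
        have "im k \<inter> G1 = im k \<inter> (G1 \<union> G2) \<inter> G1" by auto
        then show ?thesis unfolding int' start[OF k] using e1 by auto
      qed
      have i2: "im k \<inter> G2 = {pathfinish (dcurve D k)}"
      proof -
        have "im k \<inter> G2 = im k \<inter> (G1 \<union> G2) \<inter> G2" by auto
        then show ?thesis unfolding int' finish[OF k] using e2 by auto
      qed
      have S: "G1 \<subseteq> S2" "G2 \<subseteq> S2" using G12(3) partial_graph_S2[OF J] by auto
      have "finite (components (S2 - (partial_graph J \<union> im k)))"
        "card (components (S2 - (partial_graph J \<union> im k))) = card (components (S2 - partial_graph J))"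
        using components_add_arc_join[OF G12(1,2) S G12(4) arc_im[OF k] im_S2[OF k] i1 i2]
        unfolding G12(3) using IH(1) by auto
      then show ?thesis
        using IH(2) rkk False insert.hyps unfolding faces_def G image_insert kend by simp
    qed
  qed
  then show "finite (faces J)" "card (faces J) + rk (bverts H) (kend ` J) = 1 + card J" by auto
qed

end

section \<open>Connectivity of the planar dual\<close>

lemma card_image_eq_of_fibres:
  assumes "\<And>x y. x \<in> A \<Longrightarrow> y \<in> A \<Longrightarrow> f x = f y \<longleftrightarrow> g x = g y"
  shows "card (f ` A) = card (g ` A)"
proof -
  define h where "h = (\<lambda>z. g (SOME x. x \<in> A \<and> f x = z))"
  have h: "h (f x) = g x" if "x \<in> A" for x
  proof -
    have "(SOME y. y \<in> A \<and> f y = f x) \<in> A \<and> f (SOME y. y \<in> A \<and> f y = f x) = f x"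
      by (rule someI[of _ x]) (use that in auto)
    then show ?thesis using assms that by (auto simp: h_def)
  qed
  have "bij_betw h (f ` A) (g ` A)"
    unfolding bij_betw_def
  proof
    show "inj_on h (f ` A)" using h assms by (auto simp: inj_on_def)
    show "h ` f ` A = g ` A" using h by (auto simp: image_image)
  qed
  then show ?thesis by (rule bij_betw_same_card)
qed

lemma closure_finite_Union: "finite F \<Longrightarrow> closure (\<Union>F) = (\<Union>A\<in>F. closure A)"
  by (induction F rule: finite_induct) auto

lemma openin_S2_meets_closure:
  assumes "openin (top_of_set S2) U" "x \<in> U" "x \<in> closure A" "A \<subseteq> S2"
  shows "U \<inter> A \<noteq> {}"
proof -
  obtain O' where O: "open O'" "U = S2 \<inter> O'" using assms(1) unfolding openin_open by blast
  then have "O' \<inter> closure A \<noteq> {}" using assms by auto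
  then have "O' \<inter> A \<noteq> {}" using open_Int_closure_eq_empty[OF O(1)] by simp
  then show ?thesis using O(2) assms(4) by auto
qed

context plane_drawing
begin

lemma openin_face: "J \<subseteq> K \<Longrightarrow> F \<in> faces J \<Longrightarrow> openin (top_of_set S2) F"
  unfolding faces_def by (rule openin_component_S2[OF closed_partial_graph])

lemma face_subset: "F \<in> faces J \<Longrightarrow> F \<subseteq> S2 - partial_graph J"
  unfolding faces_def by (rule in_components_subset)

lemma face_nonempty: "F \<in> faces J \<Longrightarrow> F \<noteq> {}"
  unfolding faces_def by (rule in_components_nonempty)

lemma face_connected: "F \<in> faces J \<Longrightarrow> connected F"
  unfolding faces_def by (rule in_components_connected)

lemma face_eqI: "F \<in> faces J \<Longrightarrow> F' \<in> faces J \<Longrightarrow> F \<inter> F' \<noteq> {} \<Longrightarrow> F = F'"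
  unfolding faces_def using components_eq by blast

lemma Union_faces: "\<Union>(faces J) = S2 - partial_graph J"
  unfolding faces_def by (rule Union_components)

lemma face_absorbs:
  assumes "F \<in> faces J" "connected T" "T \<subseteq> S2 - partial_graph J" "F \<inter> T \<noteq> {}"
  shows "T \<subseteq> F"
  using assms components_maximal unfolding faces_def by blast

lemma openin_diff_partial_graph:
  assumes U: "openin (top_of_set S2) U" "U \<noteq> {}" and J: "J \<subseteq> K"
  shows "U - partial_graph J \<noteq> {}"
proof -
  have o: "openin (top_of_set S2) (U - P)"
    using U finite_P by (intro openin_S2_diff finite_imp_closed)
  have ne: "U - P \<noteq> {}" by (rule S2_open_diff_finite[OF U finite_P])
  have "U - P - (\<Union>g\<in>dcurve D ` J. path_image g) \<noteq> {}"
    using finite_subset[OF J finite_K] J arc_im by (intro S2_open_diff_arcs[OF o ne]) auto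
  moreover have "U - P - (\<Union>g\<in>dcurve D ` J. path_image g) = U - partial_graph J"
    by (auto simp: partial_graph_def)
  ultimately show ?thesis by metis
qed

text \<open>The drawn graph is nowhere dense, since finitely many points and arcs cover no nonempty
  open set.\<close>

lemma closure_diff_partial_graph:
  assumes U: "openin (top_of_set S2) U" and J: "J \<subseteq> K"
  shows "U \<subseteq> closure (U - partial_graph J)"
proof
  fix x assume x: "x \<in> U"
  show "x \<in> closure (U - partial_graph J)"
  proof (rule ccontr)
    assume n: "x \<notin> closure (U - partial_graph J)"
    have "openin (top_of_set S2) (U - closure (U - partial_graph J))"
      using U by (intro openin_S2_diff) auto
    then have "U - closure (U - partial_graph J) - partial_graph J \<noteq> {}"
      using n x J by (intro openin_diff_partial_graph) auto
    then show False using closure_subset[of "U - partial_graph J"] by auto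
  qed
qed

text \<open>The frontier of a region contains an edge as soon as it contains one of its inner points:
  otherwise a final piece of the edge could be opened without changing the region, although the
  remaining pendant arc does not separate.\<close>

lemma face_closure_eend:
  assumes F: "F \<in> faces K" and k: "k \<in> K" and x: "x \<in> im k" "x \<notin> P" "x \<in> closure F"
  shows "pt (eend k) \<in> closure F"
proof (rule ccontr)
  assume n: "pt (eend k) \<notin> closure F"
  define g where "g = dcurve D k"
  define G0 where "G0 = partial_graph (K - {k})"
  have g: "arc g" "path_image g \<subseteq> S2" using arc_im[OF k] im_S2[OF k] by (auto simp: g_def)
  have injg: "inj_on g {0..1}" and cg: "continuous_on {0..1} g"
    using g by (auto simp: arc_def path_def)
  have G0: "compact G0" "G0 \<subseteq> S2"
    unfolding G0_def by (intro compact_partial_graph partial_graph_S2; auto)+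
  have int: "path_image g \<inter> G0 = {pathstart g, pathfinish g}"
    unfolding G0_def g_def by (rule im_partial_graph[OF k]) auto
  have GK: "partial_graph K = G0 \<union> path_image g"
    using k by (auto simp: G0_def partial_graph_def g_def)
  have g1: "g 1 = pt (eend k)" using finish[OF k] by (simp add: pathfinish_def g_def)
  have FS: "F \<subseteq> S2 - partial_graph K" by (rule face_subset[OF F])
  obtain t0 where t0: "t0 \<in> {0..1}" "x = g t0"
    using x(1) by (auto simp: g_def path_image_def)
  have "t0 \<noteq> 1" using n x t0 g1 by auto
  moreover have "t0 \<noteq> 0"
    using x t0 start[OF k] pt_P[OF kend_bverts(1)[OF k]] by (auto simp: pathstart_def g_def)
  ultimately have t01: "0 < t0" "t0 < 1" using t0 by auto
  have "closed ({0..1} \<inter> g -` closure F)"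
    by (rule continuous_closed_preimage[OF cg]) auto
  moreover have "1 \<notin> {0..1} \<inter> g -` closure F" using n g1 by auto
  ultimately obtain d where d: "d > 0" "ball 1 d \<subseteq> - ({0..1} \<inter> g -` closure F)"
    using open_contains_ball by (metis ComplI open_Compl)
  \<comment> \<open>\<open>s\<close> is larger than \<open>t0\<close> and within
    \<open>d / 2\<close> of \<open>1\<close>, so the tail of \<open>g\<close> from \<open>s\<close>
    on avoids \<open>closure F\<close>.\<close>
  define s where "s = max ((t0 + 1) / 2) (1 - d / 2)"
  have s: "t0 < s" "s < 1" "0 < s" using t01 d by (simp_all add: s_def less_max_iff_disj)
  have off: "g t \<notin> closure F" if "s \<le> t" "t \<le> 1" for t
  proof -
    have "1 - t \<le> d / 2" using that by (simp add: s_def)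
    then have "t \<in> ball 1 d" using that d by (simp add: dist_real_def)
    then show ?thesis using d(2) that s by auto
  qed
  \<comment> \<open>Without its tail, the edge is a pendant arc attached to \<open>G0\<close> only
    at \<open>g 0\<close>; this connected intersection is what Janiszewski's theorem
    requires.\<close>
  define a where "a = subpath 0 s g"
  have a: "arc a" unfolding a_def using g(1) s injg
    by (intro arc_subpath_arc) (auto simp: inj_on_def)
  have pia: "path_image a = g ` {0..s}"
    unfolding a_def using s by (subst path_image_subpath) auto
  have asub: "path_image a \<subseteq> path_image g"
    unfolding pia unfolding path_image_def using s by auto
  have aG0: "G0 \<inter> path_image a = {g 0}"
  proof -
    have "g 1 \<notin> g ` {0..s}"
      using s inj_on_image_mem_iff[OF injg, of 1 "{0..s}"] by auto
    moreover have "g 0 \<in> g ` {0..s}" using s by auto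
    moreover have "G0 \<inter> path_image a = {g 0, g 1} \<inter> path_image a"
      using asub int unfolding pathstart_def pathfinish_def by auto
    ultimately show ?thesis unfolding pia by auto
  qed
  obtain W where W: "W \<in> components (S2 - G0)" "openin (top_of_set S2) W" "g ` {0<..<1} \<subseteq> W"
    by (rule component_Diff_arc[OF G0 g int])
  have "x \<in> W" using W(3) t0(2) t01 by auto
  then have "W \<inter> F \<noteq> {}"
    using FS by (intro openin_S2_meets_closure[OF W(2) _ x(3)]) auto
  moreover have "F \<subseteq> S2 - G0" using FS GK by auto
  ultimately have FW: "F \<subseteq> W"
    using components_maximal[OF W(1) face_connected[OF F]] by simp
  obtain z where z: "z \<in> F" using face_nonempty[OF F] by blast
  \<comment> \<open>Around the tail, \<open>W\<close> contains points outside
    \<open>closure F\<close>, and some of them lie off the edge because an arc fills no open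
    set.\<close>
  have "openin (top_of_set S2) (W - closure F)"
    using W(2) by (intro openin_S2_diff) auto
  moreover have "g ((s + 1) / 2) \<in> W - closure F"
    using W(3) off[of "(s + 1) / 2"] s by auto
  ultimately have "W - closure F - path_image g \<noteq> {}"
    using g(1) by (intro S2_open_diff_arc) auto
  then obtain z' where z': "z' \<in> W" "z' \<notin> closure F" "z' \<notin> path_image g" by blast
  have cc: "connected_component (S2 - G0) z z'"
    using connected_component_components[OF W(1)] z z' FW by blast
  have "connected (G0 \<inter> path_image a)" by (simp add: aG0)
  moreover have "path_image a \<subseteq> S2" using asub g(2) by simp
  moreover have "z \<notin> path_image a" "z' \<notin> path_image a"
    using z z' FS GK asub by auto
  ultimately have "connected_component (S2 - (G0 \<union> path_image a)) z z'"
    using Janiszewski_arc[OF G0 a _ _ cc] by blast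
  then obtain T where T: "connected T" "T \<subseteq> S2 - (G0 \<union> path_image a)" "z \<in> T" "z' \<in> T"
    unfolding connected_component_def by blast
  \<comment> \<open>\<open>T\<close> avoids the piece \<open>a\<close>, and \<open>closure F\<close>
    avoids the tail, so inside \<open>T\<close> the region is closed as well as open; this
    contradicts the connectedness of \<open>T\<close>.\<close>
  have TF: "y \<in> F" if y: "y \<in> T" "y \<in> closure F" for y
  proof -
    have "y \<notin> path_image g"
    proof
      assume "y \<in> path_image g"
      then obtain t where t: "t \<in> {0..1}" "y = g t" by (auto simp: path_image_def)
      show False
      proof (cases "t \<le> s")
        case True
        then have "y \<in> path_image a" unfolding pia using t by auto
        then show False using T y by auto
      next
        case False
        then show False using off[of t] t y by auto
      qed
    qed
    then have "y \<in> S2 - partial_graph K" using T y GK by auto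
    then obtain F' where F': "F' \<in> faces K" "y \<in> F'" using Union_faces[of K] by blast
    have "F' \<inter> F \<noteq> {}"
      using openin_face[OF order_refl F'(1)] F'(2) y(2) FS
      by (intro openin_S2_meets_closure) auto
    then show ?thesis using face_eqI[OF F'(1) F] F'(2) by simp
  qed
  obtain O' where O: "open O'" "F = S2 \<inter> O'"
    using openin_face[OF order_refl F] unfolding openin_open by blast
  have TS: "T \<subseteq> S2" using T by auto
  have "O' \<inter> (- closure F) \<inter> T = {}"
    using O(2) TS closure_subset[of F] by auto
  moreover have "T \<subseteq> O' \<union> (- closure F)"
    using TF O(2) by auto
  moreover have "O' \<inter> T \<noteq> {}" "(- closure F) \<inter> T \<noteq> {}"
    using z z' T O(2) by auto
  ultimately show False
    using connectedD[OF T(1) O(1), of "- closure F"] by auto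
qed

section \<open>Regions merged by deleting edges\<close>

definition sub_edges :: "'e set \<Rightarrow> 'k set" where
  "sub_edges A = {k \<in> K. snd (dends D k) \<in> A}"

lemma sub_edges_K: "sub_edges A \<subseteq> K"
  by (auto simp: sub_edges_def)

abbreviation "R \<equiv> faces K"
abbreviation "H' \<equiv> planar_dual H D"

lemma regions_eq: "regions H D = R"
  by (simp add: regions_def drawn_graph_def faces_def partial_graph_def)

lemma H'_sel: "hverts H' = R" "hedges H' = hedges H"
  "hinc H' e = {r \<in> R. pt (Inr e) \<in> closure r}"
  by (simp_all add: planar_dual_def regions_eq)

lemma Inr_S2: "e \<in> hedges H \<Longrightarrow> pt (Inr e) \<in> S2"
  using P_S2 pt_P[of "Inr e"] by auto

lemma finite_R: "finite R"
  by (rule Euler(1)) simp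

text \<open>The regions are dense in the sphere and finite in number, so their closures cover it.
  Hence the hyperedges of the dual are nonempty.\<close>

lemma face_at_hedge:
  assumes "e \<in> hedges H"
  shows "\<exists>r\<in>R. pt (Inr e) \<in> closure r"
proof -
  have "S2 \<subseteq> closure (\<Union>R)"
    unfolding Union_faces by (rule closure_diff_partial_graph) auto
  then show ?thesis
    using Inr_S2[OF assms] closure_finite_Union[OF finite_R] by auto
qed

lemma is_hypergraph_dual: "is_hypergraph H'"
  using H(1) face_at_hedge finite_R
  unfolding is_hypergraph_def H'_sel by blast

lemma dual_edge:
  assumes "t \<in> bedge ` incidences_at H' B"
  obtains r e where "t = {Inl r, Inr e}" "r \<in> R" "e \<in> B" "e \<in> hedges H" "pt (Inr e) \<in> closure r"
  using assms by (auto simp: incidences_at_def incidences_def H'_sel bedge_def)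

lemma dual_edgeI:
  assumes "r \<in> R" "e \<in> B" "e \<in> hedges H" "pt (Inr e) \<in> closure r"
  shows "{Inl r, Inr e} \<in> bedge ` incidences_at H' B"
  using assms by (auto simp: incidences_at_def incidences_def H'_sel bedge_def intro!: image_eqI[of _ _ "(r, e)"])

lemma partial_graph_mono: "J \<subseteq> J' \<Longrightarrow> partial_graph J \<subseteq> partial_graph J'"
  by (auto simp: partial_graph_def)

lemma face_coarser:
  assumes J: "J \<subseteq> K" and r: "r \<in> R"
  shows "\<exists>!W. W \<in> faces J \<and> r \<subseteq> W"
proof -
  have sub: "r \<subseteq> S2 - partial_graph J"
    using face_subset[OF r] partial_graph_mono[OF J] by blast
  moreover have "S2 - partial_graph J \<noteq> {}" using face_nonempty[OF r] sub by auto
  ultimately obtain W where "W \<in> faces J" "r \<subseteq> W"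
    unfolding faces_def using exists_component_superset face_connected[OF r] by metis
  then show ?thesis
    using face_eqI face_nonempty[OF r] by (metis inf.bounded_iff subset_empty)
qed

text \<open>The region of the smaller drawing into which \<open>r\<close> is absorbed.\<close>

definition coarse :: "'k set \<Rightarrow> (real^3) set \<Rightarrow> (real^3) set" where
  "coarse J r = (THE W. W \<in> faces J \<and> r \<subseteq> W)"

lemma coarse:
  assumes "J \<subseteq> K" "r \<in> R"
  shows "coarse J r \<in> faces J" "r \<subseteq> coarse J r"
  using theI'[OF face_coarser[OF assms]] by (auto simp: coarse_def)

lemma coarse_eqI:
  assumes J: "J \<subseteq> K" and r: "r \<in> R" and W: "W \<in> faces J" "W \<inter> r \<noteq> {}"
  shows "coarse J r = W"
proof (rule face_eqI[OF coarse(1)[OF J r] W(1)])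
  show "coarse J r \<inter> W \<noteq> {}" using coarse(2)[OF J r] W(2) by blast
qed

text \<open>No arc at \<open>e\<close> remains, so its point may be filled in: it then lies in one
  open component of the complement, which contains every region touching it. Deleting the point
  again does not disconnect that component.\<close>

lemma coarse_around_hedge:
  assumes B: "e \<in> B" "e \<in> hedges H" "B \<inter> A = {}"
    and r: "r \<in> R" "pt (Inr e) \<in> closure r" and r': "r' \<in> R" "pt (Inr e) \<in> closure r'"
  shows "coarse (sub_edges A) r = coarse (sub_edges A) r'"
proof -
  let ?J = "sub_edges A" and ?p = "pt (Inr e)"
  note J = sub_edges_K[of A]
  have JK: "k \<in> K" if "k \<in> ?J" for k using that J by auto
  define G where "G = (P - {?p}) \<union> (\<Union>k\<in>?J. im k)"
  have eX: "Inr e \<in> bverts H" using B by simp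
  have pG: "?p \<notin> G"
  proof
    assume "?p \<in> G"
    then obtain k where k: "k \<in> ?J" "?p \<in> im k" by (auto simp: G_def)
    then have "?p = pt (vend k) \<or> ?p = pt (eend k)"
      using im_P[OF JK[OF k(1)]] pt_P[OF eX] by auto
    then have "Inr e = vend k \<or> Inr e = eend k"
      using inj_on_eq_iff[OF inj_pt eX kend_bverts(1)[OF JK[OF k(1)]]]
        inj_on_eq_iff[OF inj_pt eX kend_bverts(2)[OF JK[OF k(1)]]] by blast
    then show False using k(1) B by (auto simp: sub_edges_def)
  qed
  have "compact G"
    unfolding G_def using finite_P by (intro compact_points_arcs J) auto
  then have cG: "closed G" by (rule compact_imp_closed)
  have GP: "S2 - G - {?p} = S2 - partial_graph ?J"
    using pt_P[OF eX] by (auto simp: G_def partial_graph_def)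
  define W where "W = connected_component_set (S2 - G) ?p"
  have W: "W \<in> components (S2 - G)"
    unfolding W_def using Inr_S2[OF B(2)] pG by (intro componentsI) auto
  have pW: "?p \<in> W"
    unfolding W_def using Inr_S2[OF B(2)] pG by simp
  have sub: "q \<subseteq> W" if q: "q \<in> R" "?p \<in> closure q" for q
  proof -
    have qS: "q \<subseteq> S2 - G - {?p}"
      unfolding GP using face_subset[OF q(1)] partial_graph_mono[OF J] by blast
    then have "W \<inter> q \<noteq> {}"
      by (intro openin_S2_meets_closure[OF openin_component_S2[OF cG W] pW q(2)]) auto
    then show ?thesis
      using qS by (intro components_maximal[OF W face_connected[OF q(1)]]) auto
  qed
  obtain x x' where x: "x \<in> r" "x' \<in> r'" using face_nonempty r r' by blast
  have "connected_component (S2 - G) x x'"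
    using connected_component_components[OF W] sub[OF r] sub[OF r'] x by blast
  moreover have "x \<noteq> ?p" "x' \<noteq> ?p"
    using x face_subset[OF r(1)] face_subset[OF r'(1)] pt_P[OF eX] by (auto simp: partial_graph_def)
  ultimately have "connected_component (S2 - partial_graph ?J) x x'"
    using connected_component_S2_delete[OF cG, of x x' ?p] GP by simp
  then obtain T where T: "connected T" "T \<subseteq> S2 - partial_graph ?J" "x \<in> T" "x' \<in> T"
    unfolding connected_component_def by blast
  have "coarse ?J r \<inter> T \<noteq> {}" using coarse(2)[OF J r(1)] x T by auto
  then have "T \<subseteq> coarse ?J r"
    by (rule face_absorbs[OF coarse(1)[OF J r(1)] T(1,2)])
  then have "coarse ?J r \<inter> r' \<noteq> {}" using T x by auto
  then show ?thesis
    using coarse_eqI[OF J r'(1) coarse(1)[OF J r(1)]] by simp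
qed

text \<open>Induction along a walk that alternates between regions and hyperedges. At a hyperedge
  the invariant speaks of all regions incident with it, so that the walk may leave through any of
  them.\<close>

lemma reach_imp_coarse:
  assumes AB: "B \<inter> A = {}" and r: "r \<in> R"
    and reach: "(Inl r, y) \<in> reach (bedge ` incidences_at H' B)"
  shows "\<And>r'. y = Inl r' \<Longrightarrow> coarse (sub_edges A) r' = coarse (sub_edges A) r"
    "\<And>e r'. y = Inr e \<Longrightarrow> r' \<in> R \<Longrightarrow> pt (Inr e) \<in> closure r' \<Longrightarrow>
      coarse (sub_edges A) r' = coarse (sub_edges A) r"
proof -
  have "(\<forall>r'. y = Inl r' \<longrightarrow> coarse (sub_edges A) r' = coarse (sub_edges A) r) \<and>
    (\<forall>e r'. y = Inr e \<longrightarrow> r' \<in> R \<longrightarrow> pt (Inr e) \<in> closure r' \<longrightarrow>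
      coarse (sub_edges A) r' = coarse (sub_edges A) r)"
    using reach
  proof (induction rule: reach_induct)
    case (step y z)
    obtain q e where q: "{y, z} = {Inl q, Inr e}" "q \<in> R" "e \<in> B" "e \<in> hedges H"
      "pt (Inr e) \<in> closure q"
      using dual_edge[OF step(2)] by blast
    then consider "y = Inl q" "z = Inr e" | "y = Inr e" "z = Inl q"
      by (auto simp: doubleton_eq_iff)
    then show ?case
    proof cases
      case 1
      then have "coarse (sub_edges A) q = coarse (sub_edges A) r" using step.IH by blast
      then show ?thesis
        using 1 coarse_around_hedge[OF q(3,4) AB _ _ q(2,5)] by auto
    next
      case 2
      then show ?thesis using step.IH q by blast
    qed
  qed auto
  then show "\<And>r'. y = Inl r' \<Longrightarrow> coarse (sub_edges A) r' = coarse (sub_edges A) r"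
    "\<And>e r'. y = Inr e \<Longrightarrow> r' \<in> R \<Longrightarrow> pt (Inr e) \<in> closure r' \<Longrightarrow>
      coarse (sub_edges A) r' = coarse (sub_edges A) r" by blast+
qed

text \<open>The closures of the regions linked to \<open>r\<close> and of the other ones cover the connected region \<open>W\<close>
  of the smaller graph, so they meet in \<open>W\<close>, necessarily on a removed edge; but its hyperedge
  links the two regions in question.\<close>

lemma coarse_imp_reach:
  assumes AB: "hedges H - A = B" and r: "r \<in> R" and r': "r' \<in> R"
    and eq: "coarse (sub_edges A) r' = coarse (sub_edges A) r"
  shows "(Inl r, Inl r') \<in> reach (bedge ` incidences_at H' B)"
proof (rule ccontr)
  assume n: "\<not> ?thesis"
  let ?J = "sub_edges A" and ?S = "bedge ` incidences_at H' B"
  note J = sub_edges_K[of A]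
  define W where "W = coarse ?J r"
  define Pr where "Pr = {q \<in> R. (Inl r, Inl q) \<in> reach ?S}"
  define Qr where "Qr = {q \<in> R. (Inl r, Inl q) \<notin> reach ?S}"
  have W: "W \<in> faces ?J" using coarse(1)[OF J r] by (simp add: W_def)
  have PQ: "Pr \<union> Qr = R" by (auto simp: Pr_def Qr_def)
  have fin: "finite Pr" "finite Qr" using finite_R by (auto simp: Pr_def Qr_def)
  have "W - partial_graph K \<subseteq> \<Union>Pr \<union> \<Union>Qr"
  proof -
    have "W \<subseteq> S2" using face_subset[OF W] by auto
    then have "W - partial_graph K \<subseteq> \<Union>R" unfolding Union_faces by auto
    then show ?thesis unfolding PQ[symmetric] Union_Un_distrib .
  qed
  then have "closure (W - partial_graph K) \<subseteq> closure (\<Union>Pr) \<union> closure (\<Union>Qr)"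
    using closure_mono closure_Un by metis
  then have cover: "W \<subseteq> closure (\<Union>Pr) \<union> closure (\<Union>Qr)"
    using closure_diff_partial_graph[OF openin_face[OF J W] order_refl] by auto
  have "r \<in> Pr" using r by (simp add: Pr_def)
  then have "closure (\<Union>Pr) \<inter> W \<noteq> {}"
    using coarse(2)[OF J r] face_nonempty[OF r] closure_subset[of "\<Union>Pr"] unfolding W_def by blast
  moreover have "r' \<in> Qr" using r' n by (simp add: Qr_def)
  then have "closure (\<Union>Qr) \<inter> W \<noteq> {}"
    using coarse(2)[OF J r'] face_nonempty[OF r'] closure_subset[of "\<Union>Qr"]
    unfolding W_def eq by blast
  ultimately have "closure (\<Union>Pr) \<inter> closure (\<Union>Qr) \<inter> W \<noteq> {}"
    using face_connected[OF W] cover closed_closure unfolding connected_closed by metis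
  then obtain x p q where x: "x \<in> W" and p: "p \<in> Pr" "x \<in> closure p" and q: "q \<in> Qr" "x \<in> closure q"
    unfolding closure_finite_Union[OF fin(1)] closure_finite_Union[OF fin(2)] by blast
  have pR: "p \<in> R" and qR: "q \<in> R" using p q by (auto simp: Pr_def Qr_def)
  have xJ: "x \<in> S2" "x \<notin> partial_graph ?J" using x face_subset[OF W] by auto
  have "(Inl p, Inl q) \<in> reach ?S"
  \<comment> \<open>Off the drawing, the open region containing \<open>x\<close> meets both
    \<open>p\<close> and \<open>q\<close> and so equals both. On the drawing, \<open>x\<close> is an
    inner point of a deleted arc, whose hyperedge point lies in both closures.\<close>
  proof (cases "x \<in> partial_graph K")
    case False
    then obtain s where s: "s \<in> R" "x \<in> s" using xJ Union_faces[of K] by blast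
    have "s \<inter> t \<noteq> {}" if "t \<in> R" "x \<in> closure t" for t
      using face_subset[OF that(1)]
      by (intro openin_S2_meets_closure[OF openin_face[OF order_refl s(1)] s(2) that(2)]) auto
    then have "s = p" "s = q"
      using face_eqI[OF s(1)] pR qR p q by blast+
    then show ?thesis by simp
  next
    case True
    then obtain k where k: "k \<in> K" "x \<in> im k" "k \<notin> ?J"
      using xJ by (auto simp: partial_graph_def)
    have xP: "x \<notin> P" using xJ by (simp add: partial_graph_def)
    let ?e = "snd (dends D k)"
    have e: "?e \<in> hedges H" using kend_bverts(2)[OF k(1)] by (auto simp: bverts_def)
    then have eB: "?e \<in> B" using k AB by (auto simp: sub_edges_def)
    have "{Inl p, Inr ?e} \<in> ?S" "{Inl q, Inr ?e} \<in> ?S"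
      using face_closure_eend[OF pR k(1,2) xP p(2)] face_closure_eend[OF qR k(1,2) xP q(2)]
        dual_edgeI[OF pR eB e] dual_edgeI[OF qR eB e] by auto
    then have "(Inl p, Inr ?e) \<in> reach ?S" "(Inl q, Inr ?e) \<in> reach ?S"
      by (auto intro: reach_edge)
    then show ?thesis by (rule reach_trans[OF _ reach_sym])
  qed
  then have "(Inl r, Inl q) \<in> reach ?S"
    using p by (auto simp: Pr_def intro: reach_trans)
  then show False using q by (simp add: Qr_def)
qed

lemma coarse_image: "coarse (sub_edges A) ` R = faces (sub_edges A)"
proof (intro equalityI subsetI)
  note J = sub_edges_K[of A]
  fix W assume W: "W \<in> faces (sub_edges A)"
  have "W - partial_graph K \<noteq> {}"
    by (rule openin_diff_partial_graph[OF openin_face[OF J W] face_nonempty[OF W]]) simp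
  then obtain x where x: "x \<in> W" "x \<notin> partial_graph K" by blast
  then have "x \<in> \<Union>R" using face_subset[OF W] Union_faces[of K] by auto
  then obtain r where r: "r \<in> R" "x \<in> r" by blast
  then have "coarse (sub_edges A) r = W"
    using x by (intro coarse_eqI[OF J _ W]) auto
  then show "W \<in> coarse (sub_edges A) ` R" using r by blast
qed (use coarse(1) sub_edges_K in auto)

text \<open>The hyperedges in \<open>A\<close> are isolated nodes. Every other component contains a
  region, and two regions lie in the same one exactly when they are absorbed into the same
  face.\<close>

lemma ncomp_dual:
  assumes A: "A \<subseteq> hedges H"
  shows "ncomp (bverts H') (bedge ` incidences_at H' (hedges H - A))
    = card (faces (sub_edges A)) + card A"
proof -
  let ?B = "hedges H - A" and ?S = "bedge ` incidences_at H' (hedges H - A)"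
  let ?X' = "R <+> ?B"
  have sub: "?X' \<subseteq> bverts H'" by (auto simp: bverts_def H'_sel)
  have "ncomp (bverts H') ?S = ncomp ?X' ?S + card (bverts H' - ?X')"
    by (rule ncomp_extend[OF finite_bverts[OF is_hypergraph_dual] sub]) (auto elim!: dual_edge)
  moreover have "bverts H' - ?X' = Inr ` A"
    using A by (auto simp: bverts_def H'_sel)
  then have "card (bverts H' - ?X') = card A" by (simp add: card_image)
  moreover have "ncomp ?X' ?S = card (faces (sub_edges A))"
  proof -
    have "cls ?X' ?S ` ?X' = cls ?X' ?S ` Inl ` R"
    proof
      have "cls ?X' ?S (Inr e) \<in> cls ?X' ?S ` Inl ` R" if e: "e \<in> ?B" for e
      proof -
        obtain r where r: "r \<in> R" "pt (Inr e) \<in> closure r" using face_at_hedge e by auto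
        then have "{Inl r, Inr e} \<in> ?S" using e by (intro dual_edgeI) auto
        then have "(Inl r, Inr e) \<in> reach ?S" by (rule reach_edge)
        then have "cls ?X' ?S (Inl r) = cls ?X' ?S (Inr e)"
          using r e by (subst cls_eq_iff) auto
        then show ?thesis using r(1) by (metis image_eqI)
      qed
      then show "cls ?X' ?S ` ?X' \<subseteq> cls ?X' ?S ` Inl ` R" by auto
    qed auto
    then have "ncomp ?X' ?S = card ((\<lambda>r. cls ?X' ?S (Inl r)) ` R)"
      by (simp add: ncomp_def ugraph_components_cls image_image)
    also have "\<dots> = card (coarse (sub_edges A) ` R)"
    proof (rule card_image_eq_of_fibres)
      fix r r' assume r: "r \<in> R" "r' \<in> R"
      have "cls ?X' ?S (Inl r) = cls ?X' ?S (Inl r') \<longleftrightarrow> (Inl r, Inl r') \<in> reach ?S"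
        using r by (intro cls_eq_iff) auto
      also have "\<dots> \<longleftrightarrow> coarse (sub_edges A) r = coarse (sub_edges A) r'"
        using reach_imp_coarse(1)[of ?B A r "Inl r'" r'] coarse_imp_reach[OF refl r, of A] r by auto
      finally show "cls ?X' ?S (Inl r) = cls ?X' ?S (Inl r') \<longleftrightarrow>
        coarse (sub_edges A) r = coarse (sub_edges A) r'" .
    qed
    finally show ?thesis by (simp add: coarse_image)
  qed
  ultimately show ?thesis by simp
qed

text \<open>The case of an empty \<open>A\<close>: with all arcs deleted, finitely many points
  remain, and their complement is a single face.\<close>

lemma connected_dual: "ugraph_connected (Bip H')"
proof -
  have "faces {} = {S2 - P}"
    unfolding faces_def partial_graph_def using connected_S2_diff_finite[OF finite_P]
      openin_diff_partial_graph[OF openin_subtopology_self, of "{}"]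
    by (simp add: components_eq_sing_iff partial_graph_def)
  moreover have "sub_edges {} = {}" by (simp add: sub_edges_def)
  ultimately have 1: "ncomp (bverts H') (bedge ` incidences_at H' (hedges H)) = 1"
    using ncomp_dual[of "{}"] by simp
  have "incidences_at H' (hedges H) = incidences H'"
    by (auto simp: incidences_at_def incidences_def H'_sel)
  moreover have "bverts H' \<noteq> {}"
    using 1 by (auto simp: ncomp_def ugraph_components_cls)
  ultimately show ?thesis
    unfolding Bip_eq using 1 ugraph_connected_iff_ncomp[OF finite_bverts[OF is_hypergraph_dual]] by simp
qed

section \<open>Duality of the two rank functions\<close>

text \<open>Parallel drawn edges have the same image under \<open>kend\<close>, so the rank sees
  only the reduced graph \<open>Bip H\<close>.\<close>

lemma hrank_sub_edges: "hrank H A = rk (bverts H) (kend ` sub_edges A)"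
proof -
  have "dends D ` sub_edges A = incidences_at H A"
    unfolding incidences_at_def dends_K[symmetric] by (auto simp: sub_edges_def)
  then have "bedge ` incidences_at H A = kend ` sub_edges A"
    by (metis image_image)
  then show ?thesis by (simp add: hrank_def)
qed

lemma Euler_hrank:
  "card (faces (sub_edges A)) + hrank H A = 1 + card (sub_edges A)"
  unfolding hrank_sub_edges by (rule Euler(2)[OF sub_edges_K])

lemma sub_edges_hedges: "sub_edges (hedges H) = K"
  using kend_bverts(2) by (auto simp: sub_edges_def bverts_def)

lemma hrank_hedges: "hrank H (hedges H) + 1 = card (hverts H) + card (hedges H)"
proof -
  have "incidences_at H (hedges H) = incidences H"
    by (auto simp: incidences_at_def incidences_def)
  moreover have "bverts H \<noteq> {}" using hverts_nonempty[OF H] by (auto simp: bverts_def)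
  moreover have "card (bverts H) > 0" using calculation(2) finite_bverts[OF H(1)] card_gt_0_iff by blast
  ultimately show ?thesis
    using H(2) rk_connected[OF finite_bverts[OF H(1)]] card_bverts[OF H(1)]
    unfolding hrank_def Bip_eq by simp
qed

text \<open>The classical Euler formula: vertices and hyperedges are the nodes of the connected
  plane graph.\<close>

lemma card_R: "int (card R) + int (card (hverts H)) + int (card (hedges H)) = int (card K) + 2"
  using Euler_hrank[of "hedges H"] hrank_hedges unfolding sub_edges_hedges by linarith

text \<open>Parallel edges count separately. Hyperedges are nonempty, so there is at least one drawn
  edge at each of them and the subtraction is exact.\<close>

definition edeg :: "'e \<Rightarrow> nat" where
  "edeg e = card (sub_edges {e}) - 1"

lemma sum_edeg:
  assumes "B \<subseteq> hedges H"
  shows "(\<Sum>e\<in>B. int (edeg e)) = int (card (sub_edges B)) - int (card B)"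
proof -
  have fin: "finite B" using assms H(1) finite_subset by (auto simp: is_hypergraph_def)
  have finS: "finite (sub_edges A)" for A using finite_subset[OF sub_edges_K finite_K] .
  have "int (edeg e) = int (card (sub_edges {e})) - 1" if "e \<in> B" for e
  proof -
    have e: "e \<in> hedges H" using that assms by auto
    then obtain v where "v \<in> hinc H e" "v \<in> hverts H" using H(1) by (auto simp: is_hypergraph_def)
    then have "(v, e) \<in> dends D ` K" using e unfolding dends_K by (simp add: incidences_def)
    then obtain k where "k \<in> K" "dends D k = (v, e)" by auto
    then have "k \<in> sub_edges {e}" by (simp add: sub_edges_def)
    then have "sub_edges {e} \<noteq> {}" by blast
    then have "card (sub_edges {e}) > 0" using finS card_gt_0_iff by blast
    then show ?thesis by (simp add: edeg_def)
  qed
  then have "(\<Sum>e\<in>B. int (edeg e)) = (\<Sum>e\<in>B. int (card (sub_edges {e}))) - int (card B)"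
    by (simp add: sum_subtractf)
  moreover have "sub_edges B = (\<Union>e\<in>B. sub_edges {e})" by (auto simp: sub_edges_def)
  moreover have "card (\<Union>e\<in>B. sub_edges {e}) = (\<Sum>e\<in>B. card (sub_edges {e}))"
  proof (rule card_UN_disjoint[OF fin])
    show "\<forall>i\<in>B. finite (sub_edges {i})" using finS by blast
    show "\<forall>i\<in>B. \<forall>j\<in>B. i \<noteq> j \<longrightarrow> sub_edges {i} \<inter> sub_edges {j} = {}"
      by (auto simp: sub_edges_def)
  qed
  ultimately show ?thesis by simp
qed

text \<open>The component count of the dual graph expresses its rank through the faces of the
  partial drawing; Euler's formula for \<open>A\<close> eliminates these faces, and the formula for
  the whole drawing eliminates the number of regions.\<close>

lemma hmu_planar_dual:
  assumes A: "A \<subseteq> hedges H"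
  shows "hmu H' (hedges H - A) =
    (\<Sum>e\<in>hedges H - A. int (edeg e)) + hmu H A - (int (card (hverts H)) - 1)"
proof -
  let ?B = "hedges H - A"
  have fE: "finite (hedges H)" using H(1) by (simp add: is_hypergraph_def)
  have cB: "int (card ?B) + int (card A) = int (card (hedges H))"
    using card_Diff_subset[OF finite_subset[OF A fE] A] card_mono[OF fE A] by linarith
  have cX: "card (bverts H') = card R + card (hedges H)"
    using card_bverts[OF is_hypergraph_dual] by (simp add: H'_sel)
  have "ncomp (bverts H') (bedge ` incidences_at H' ?B) \<le> card (bverts H')"
    by (rule ncomp_le[OF finite_bverts[OF is_hypergraph_dual]])
  then have r: "int (hrank H' ?B) = int (card R) + int (card (hedges H))
      - int (card (faces (sub_edges A))) - int (card A)"
    unfolding hrank_def rk_def ncomp_dual[OF A] cX by linarith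
  have "K = sub_edges A \<union> sub_edges ?B" "sub_edges A \<inter> sub_edges ?B = {}"
    using kend_bverts(2) by (auto simp: sub_edges_def bverts_def)
  then have cK: "card K = card (sub_edges A) + card (sub_edges ?B)"
    using card_Un_disjoint[OF finite_subset[OF sub_edges_K finite_K] finite_subset[OF sub_edges_K finite_K]]
    by metis
  have "(\<Sum>e\<in>?B. int (edeg e)) = int (card (sub_edges ?B)) - int (card ?B)"
    by (rule sum_edeg) auto
  then show ?thesis
    using r cK cB card_R Euler_hrank[of A] unfolding hmu_def by linarith
qed

sublocale dual_hypergraphs H "planar_dual H D" edeg
proof
  show "int (card (hverts H')) - 1 = (\<Sum>e\<in>hedges H. int (edeg e)) - (int (card (hverts H)) - 1)"
    using card_R sum_edeg[OF order_refl] unfolding H'_sel sub_edges_hedges by linarith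
qed (use H is_hypergraph_dual connected_dual H'_sel hmu_planar_dual in auto)

end

theorem theorem8p3:
  fixes H :: "('v, 'e) hypergraph"
    and D :: "('v, 'e, 'k) drawing"
    and H' :: "((real^3) set, 'e) hypergraph"
  assumes "plane_hypergraph H D"
    and "H' = planar_dual H D"
  shows "(\<exists>c \<in> hedges H \<rightarrow>\<^sub>E (UNIV :: real set).
            hypertree_polytope H' =
              (\<lambda>x. \<lambda>e\<in>hedges H. 2 * c e - x e) ` hypertree_polytope H) \<and>
         (\<forall>r. linear_order_on (hedges H) r \<longrightarrow>
            interior_polynomial r H' = exterior_polynomial r H \<and>
            exterior_polynomial r H' = interior_polynomial r H)"
proof -
  interpret plane_drawing H D
    by unfold_locales (rule assms(1))
  show ?thesis
    unfolding assms(2) by (rule hypertree_duality)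
qed

end
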